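(* Let $(M,\Pi)$ be a Poisson manifold and let $\star$ be a local star product on $\mathcal{C}^\infty(M)$. Then for each closed subset $X\subset M$ the subspace $\mathcal{J}^\infty(X,M)[[\hbar]]$ is an ideal in $\big(\mathcal{C}^\infty(M)[[\hbar]],\star\big)$, and it gives rise to an exact sequence of deformed algebras $$0\rightarrow\big(\mathcal{J}^\infty(X,M)[[\hbar]],\star\big)\rightarrow\big(\mathcal{C}^\infty(M)[[\hbar]],\star\big)\rightarrow\big(\mathcal{E}^\infty(X)[[\hbar]],\star\big)\rightarrow 0,$$ where the star product induced on $\mathcal{E}^\infty(X)[[\hbar]]$, which is a star product for the global Whitney--Poisson structure on $X$, is denoted by $\star$ as well.
   Context: Functions are complex-valued. For a smooth manifold $M$ and a closed subset $X\subset M$, $\mathcal{J}^\infty(X,M)\subset\mathcal{C}^\infty(M)$ is the ideal of smooth functions flat on $X$, i.e. of all $f\in\mathcal{C}^\infty(M)$ such that $(Df)|_X=0$ for every differential operator $D$ on $M$. The algebra of Whitney functions on $X$ is $\mathcal{E}^\infty(X):=\mathcal{C}^\infty(M)/\mathcal{J}^\infty(X,M)$; in particular $\mathcal{E}^\infty(M)=\mathcal{C}^\infty(M)$. A Whitney--Poisson structure on $X$ is an antisymmetric bilinear bracket $\{-,-\}$ on $\mathcal{E}^\infty(X)$ satisfying $\{F,GH\}=\{F,G\}H+G\{F,H\}$ and the Jacobi identity. If $(M,\Pi)$ is a Poisson manifold, $\mathcal{J}^\infty(X,M)$ is a Poisson ideal of $\mathcal{C}^\infty(M)$, so the Poisson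 bracket descends to $\mathcal{E}^\infty(X)$; the resulting bracket is called the global Whitney--Poisson structure. A star product (formal deformation quantization) on $\mathcal{E}^\infty(X)$ with a given Whitney--Poisson structure is an associative product $\star$ on $\mathcal{E}^\infty(X)[[\hbar]]$ such that: (DQ0) $\star$ is $\mathbb{R}[[\hbar]]$-linear and $\hbar$-adically continuous in each argument; (DQ1) there are $\mathbb{R}$-bilinear operators $c_k:\mathcal{E}^\infty(X)\times\mathcal{E}^\infty(X)\to\mathcal{E}^\infty(X)$, $k\in\mathbb{N}$ (with $0\in\mathbb{N}$), with $c_0$ the commutative product, such that $F\star G=\sum_{k\in\mathbb{N}}c_k(F,G)\hbar^k$ for $F,G\in\mathcal{E}^\infty(X)$; (DQ2) $1\star F=F\star 1=F$ for all $F\in\mathcal{E}^\infty(X)$; (DQ3) $F\star G-G\star F=-i\hbar\{F,G\}$ modulo $\hbar^2\mathcal{E}^\infty(X)[[\hbar]]$ for all $F,G\in\mathcal{E}^\infty(X)$. The star product is local if in addition (DQ4) $\operatorname{supp}(F\star G)\subset\operatorname{supp}(F)\cap\operatorname{supp}(G)$ for all $F,G\in\mathcal{E}^\infty(X)$. Taking $X=M$ gives the notion of a (local) star product on $\mathcal{C}^\infty(M)$ for the Poisson bracket of $\Pi$. *)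

theory Defs
  imports
    "HOL-Analysis.Analysis"
    "HOL-Algebra.QuotRing"
    "HOL-Algebra.Module"
    "HOL-Computational_Algebra.Formal_Power_Series"
begin

section \<open>Smooth manifolds\<close>

fun iter_deriv :: "'e::real_normed_vector list \<Rightarrow> ('e \<Rightarrow> 'b::real_normed_vector) \<Rightarrow> 'e \<Rightarrow> 'b" where
  "iter_deriv [] f = f"
| "iter_deriv (v # vs) f = (\<lambda>y. frechet_derivative (iter_deriv vs f) (at y) v)"

text \<open>Only meant for open \<open>S\<close>; there, in finite dimension, this is the usual \<open>C\<^sup>\<infinity>\<close>: all iterated
  directional derivatives exist and are (Frechet) differentiable, hence continuous.\<close>

definition smooth_on :: "'e::real_normed_vector set \<Rightarrow> ('e \<Rightarrow> 'b::real_normed_vector) \<Rightarrow> bool" where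
  "smooth_on S f \<longleftrightarrow> (\<forall>vs. \<forall>y\<in>S. iter_deriv vs f differentiable (at y))"

type_synonym ('m, 'e) chart = "'m set \<times> ('m \<Rightarrow> 'e)"

text \<open>The manifold is the whole type \<open>'m\<close>. Its model space \<open>'e\<close> is a finite-dimensional
  inner product space. The class \<open>euclidean_space\<close> is avoided because it excludes dimension zero;
  \<open>heine_borel\<close> is no restriction, as every finite-dimensional normed space has this property.
  The atlas need not be maximal.\<close>

definition smooth_manifold ::
  "('m::{t2_space,second_countable_topology}, 'e::{real_inner,heine_borel}) chart set \<Rightarrow> bool" where
  "smooth_manifold atlas \<longleftrightarrow>
     (\<exists>B::'e set. finite B \<and> span B = UNIV) \<and>
     (\<Union>(U, \<phi>)\<in>atlas. U) = UNIV \<and>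
     (\<forall>(U, \<phi>)\<in>atlas. open U \<and> open (\<phi> ` U) \<and> homeomorphism U (\<phi> ` U) \<phi> (inv_into U \<phi>)) \<and>
     (\<forall>(U, \<phi>)\<in>atlas. \<forall>(V, \<psi>)\<in>atlas. smooth_on (\<phi> ` (U \<inter> V)) (\<psi> \<circ> inv_into U \<phi>))"

definition smooth_functions ::
  "('m, 'e::real_normed_vector) chart set \<Rightarrow> ('m \<Rightarrow> complex) set" where
  "smooth_functions atlas = {f. \<forall>(U, \<phi>)\<in>atlas. smooth_on (\<phi> ` U) (f \<circ> inv_into U \<phi>)}"

definition smooth_algebra ::
  "('m, 'e::real_normed_vector) chart set \<Rightarrow> (complex, 'm \<Rightarrow> complex) module" where
  "smooth_algebra atlas =
     \<lparr>carrier = smooth_functions atlas,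
      mult = (\<lambda>f g x. f x * g x), one = (\<lambda>x. 1),
      zero = (\<lambda>x. 0), add = (\<lambda>f g x. f x + g x),
      smult = (\<lambda>c f x. c * f x)\<rparr>"

section \<open>Whitney functions\<close>

text \<open>Operators on smooth functions that have, in each chart, the form
  \<open>\<Sum>l. a l \<cdot> \<partial>\<^sub>l\<close> with a finite sum, smooth complex coefficients \<open>a l\<close>, and iterated
  directional derivatives \<open>\<partial>\<^sub>l\<close> of order bounded independently of the chart.\<close>

definition differential_operator ::
  "('m, 'e::real_normed_vector) chart set \<Rightarrow> (('m \<Rightarrow> complex) \<Rightarrow> ('m \<Rightarrow> complex)) \<Rightarrow> bool" where
  "differential_operator atlas D \<longleftrightarrow>
     D \<in> smooth_functions atlas \<rightarrow> smooth_functions atlas \<and>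
     (\<exists>N::nat. \<forall>(U, \<phi>)\<in>atlas. \<exists>L (a :: 'e list \<Rightarrow> 'e \<Rightarrow> complex).
        finite L \<and> (\<forall>l\<in>L. length l \<le> N \<and> smooth_on (\<phi> ` U) (a l)) \<and>
        (\<forall>f\<in>smooth_functions atlas. \<forall>x\<in>U.
           D f x = (\<Sum>l\<in>L. a l (\<phi> x) * iter_deriv l (f \<circ> inv_into U \<phi>) (\<phi> x))))"

definition flat_ideal ::
  "('m, 'e::real_normed_vector) chart set \<Rightarrow> 'm set \<Rightarrow> ('m \<Rightarrow> complex) set" where
  "flat_ideal atlas X =
     {f \<in> smooth_functions atlas. \<forall>D. differential_operator atlas D \<longrightarrow> (\<forall>x\<in>X. D f x = 0)}"

text \<open>The quotient ring of smooth functions by the flat ones, with its complex scalar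
  multiplication; the latter is written in the style of \<open>rcoset_mult\<close>.\<close>

definition whitney_algebra ::
  "('m, 'e::real_normed_vector) chart set \<Rightarrow> 'm set \<Rightarrow> (complex, ('m \<Rightarrow> complex) set) module" where
  "whitney_algebra atlas X =
     (let C = smooth_algebra atlas; J = flat_ideal atlas X; E = C Quot J in
      \<lparr>carrier = carrier E, mult = mult E, one = one E, zero = zero E, add = add E,
       smult = (\<lambda>c F. \<Union>f\<in>F. J +>\<^bsub>C\<^esub> (c \<odot>\<^bsub>C\<^esub> f))\<rparr>)"

section \<open>Poisson structures\<close>

definition bilinear_over ::
  "'k set \<Rightarrow> ('k, 'a) module \<Rightarrow> ('a \<Rightarrow> 'a \<Rightarrow> 'a) \<Rightarrow> bool" where
  "bilinear_over K A p \<longleftrightarrow>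
     (\<forall>F\<in>carrier A. \<forall>G\<in>carrier A. p F G \<in> carrier A) \<and>
     (\<forall>F\<in>carrier A. \<forall>F'\<in>carrier A. \<forall>G\<in>carrier A.
        p (F \<oplus>\<^bsub>A\<^esub> F') G = p F G \<oplus>\<^bsub>A\<^esub> p F' G \<and> p G (F \<oplus>\<^bsub>A\<^esub> F') = p G F \<oplus>\<^bsub>A\<^esub> p G F') \<and>
     (\<forall>r\<in>K. \<forall>F\<in>carrier A. \<forall>G\<in>carrier A.
        p (r \<odot>\<^bsub>A\<^esub> F) G = r \<odot>\<^bsub>A\<^esub> p F G \<and> p F (r \<odot>\<^bsub>A\<^esub> G) = r \<odot>\<^bsub>A\<^esub> p F G)"

locale whitney_poisson =
  fixes A :: "(complex, 'a) module" (structure)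
    and br :: "'a \<Rightarrow> 'a \<Rightarrow> 'a"
  assumes br_bilinear: "bilinear_over UNIV A br"
    and br_antisym: "\<lbrakk>F \<in> carrier A; G \<in> carrier A\<rbrakk> \<Longrightarrow> br F G = \<ominus> br G F"
    and br_leibniz: "\<lbrakk>F \<in> carrier A; G \<in> carrier A; H \<in> carrier A\<rbrakk> \<Longrightarrow>
      br F (G \<otimes> H) = br F G \<otimes> H \<oplus> G \<otimes> br F H"
    and br_jacobi: "\<lbrakk>F \<in> carrier A; G \<in> carrier A; H \<in> carrier A\<rbrakk> \<Longrightarrow>
      br F (br G H) \<oplus> br G (br H F) \<oplus> br H (br F G) = \<zero>"

text \<open>A bivector field is given by its chart representations: \<open>P c y\<close> is the bilinear form on
  covectors at the point with coordinate \<open>y\<close> in the chart \<open>c\<close>. The last clause is the tensor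
  transformation law, where covectors are pulled back along the derivative of the transition map.\<close>

definition bivector_field ::
  "('m, 'e::real_normed_vector) chart set \<Rightarrow>
   (('m, 'e) chart \<Rightarrow> 'e \<Rightarrow> ('e \<Rightarrow>\<^sub>L real) \<Rightarrow> ('e \<Rightarrow>\<^sub>L real) \<Rightarrow> real) \<Rightarrow> bool" where
  "bivector_field atlas P \<longleftrightarrow>
     (\<forall>(U, \<phi>)\<in>atlas.
        (\<forall>y\<in>\<phi> ` U. bilinear (P (U, \<phi>) y) \<and> (\<forall>\<alpha> \<beta>. P (U, \<phi>) y \<alpha> \<beta> = - P (U, \<phi>) y \<beta> \<alpha>)) \<and>
        (\<forall>\<alpha> \<beta>. smooth_on (\<phi> ` U) (\<lambda>y. P (U, \<phi>) y \<alpha> \<beta>))) \<and>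
     (\<forall>(U, \<phi>)\<in>atlas. \<forall>(V, \<psi>)\<in>atlas. \<forall>x\<in>U \<inter> V. \<forall>\<alpha> \<beta>.
        let T = Blinfun (frechet_derivative (\<psi> \<circ> inv_into U \<phi>) (at (\<phi> x)))
        in P (V, \<psi>) (\<psi> x) \<alpha> \<beta> = P (U, \<phi>) (\<phi> x) (\<alpha> o\<^sub>L T) (\<beta> o\<^sub>L T))"

definition chart_differential ::
  "('m, 'e::real_normed_vector) chart \<Rightarrow> ('m \<Rightarrow> real) \<Rightarrow> 'm \<Rightarrow> ('e \<Rightarrow>\<^sub>L real)" where
  "chart_differential c u x =
     Blinfun (frechet_derivative (u \<circ> inv_into (fst c) (snd c)) (at (snd c x)))"

text \<open>\<open>P(du, dv)\<close> for real functions; by the transformation law the chart chosen is irrelevant.\<close>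

definition real_bracket ::
  "('m, 'e::real_normed_vector) chart set \<Rightarrow>
   (('m, 'e) chart \<Rightarrow> 'e \<Rightarrow> ('e \<Rightarrow>\<^sub>L real) \<Rightarrow> ('e \<Rightarrow>\<^sub>L real) \<Rightarrow> real) \<Rightarrow>
   ('m \<Rightarrow> real) \<Rightarrow> ('m \<Rightarrow> real) \<Rightarrow> 'm \<Rightarrow> real" where
  "real_bracket atlas P u v x =
     (let c = (SOME c. c \<in> atlas \<and> x \<in> fst c)
      in P c (snd c x) (chart_differential c u x) (chart_differential c v x))"

text \<open>The complex bilinear extension of the previous bracket.\<close>

definition poisson_bracket ::
  "('m, 'e::real_normed_vector) chart set \<Rightarrow>
   (('m, 'e) chart \<Rightarrow> 'e \<Rightarrow> ('e \<Rightarrow>\<^sub>L real) \<Rightarrow> ('e \<Rightarrow>\<^sub>L real) \<Rightarrow> real) \<Rightarrow>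
   ('m \<Rightarrow> complex) \<Rightarrow> ('m \<Rightarrow> complex) \<Rightarrow> 'm \<Rightarrow> complex" where
  "poisson_bracket atlas P f g x =
     Complex
       (real_bracket atlas P (Re \<circ> f) (Re \<circ> g) x - real_bracket atlas P (Im \<circ> f) (Im \<circ> g) x)
       (real_bracket atlas P (Re \<circ> f) (Im \<circ> g) x + real_bracket atlas P (Im \<circ> f) (Re \<circ> g) x)"

definition poisson_manifold ::
  "('m::{t2_space,second_countable_topology}, 'e::{real_inner,heine_borel}) chart set \<Rightarrow>
   (('m, 'e) chart \<Rightarrow> 'e \<Rightarrow> ('e \<Rightarrow>\<^sub>L real) \<Rightarrow> ('e \<Rightarrow>\<^sub>L real) \<Rightarrow> real) \<Rightarrow> bool" where
  "poisson_manifold atlas P \<longleftrightarrow>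
     smooth_manifold atlas \<and> bivector_field atlas P \<and>
     (\<forall>f\<in>smooth_functions atlas. \<forall>g\<in>smooth_functions atlas. \<forall>h\<in>smooth_functions atlas. \<forall>x.
        poisson_bracket atlas P f (poisson_bracket atlas P g h) x +
        poisson_bracket atlas P g (poisson_bracket atlas P h f) x +
        poisson_bracket atlas P h (poisson_bracket atlas P f g) x = 0)"

text \<open>The bracket induced on cosets, again in the style of \<open>rcoset_mult\<close>.\<close>

definition global_whitney_bracket ::
  "('m, 'e::real_normed_vector) chart set \<Rightarrow>
   (('m, 'e) chart \<Rightarrow> 'e \<Rightarrow> ('e \<Rightarrow>\<^sub>L real) \<Rightarrow> ('e \<Rightarrow>\<^sub>L real) \<Rightarrow> real) \<Rightarrow> 'm set \<Rightarrow>
   ('m \<Rightarrow> complex) set \<Rightarrow> ('m \<Rightarrow> complex) set \<Rightarrow> ('m \<Rightarrow> complex) set" where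
  "global_whitney_bracket atlas P X F G =
     (\<Union>f\<in>F. \<Union>g\<in>G. flat_ideal atlas X +>\<^bsub>smooth_algebra atlas\<^esub> poisson_bracket atlas P f g)"

section \<open>Formal power series in \<open>\<hbar>\<close> and star products\<close>

text \<open>A series \<open>\<Sum>k. a k \<cdot> \<hbar>^k\<close> over an algebra is the sequence \<open>a\<close> of its coefficients.\<close>

definition hseries :: "'a set \<Rightarrow> (nat \<Rightarrow> 'a) set" where
  "hseries S = {a. \<forall>k. a k \<in> S}"

text \<open>The series \<open>F \<cdot> \<hbar>^n\<close>; in particular \<open>hmonom A 0\<close> embeds the algebra into its series.\<close>

definition hmonom :: "(complex, 'a) module \<Rightarrow> nat \<Rightarrow> 'a \<Rightarrow> nat \<Rightarrow> 'a" where
  "hmonom A n F = (\<lambda>k. if k = n then F else \<zero>\<^bsub>A\<^esub>)"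

text \<open>Congruence modulo \<open>\<hbar>^n\<close>.\<close>

definition hcong :: "nat \<Rightarrow> (nat \<Rightarrow> 'a) \<Rightarrow> (nat \<Rightarrow> 'a) \<Rightarrow> bool" where
  "hcong n a b \<longleftrightarrow> (\<forall>k<n. a k = b k)"

text \<open>The series over \<open>A\<close> with product \<open>st\<close>, as an algebra over the real formal power series.\<close>

definition deformed ::
  "(complex, 'a) module \<Rightarrow> ((nat \<Rightarrow> 'a) \<Rightarrow> (nat \<Rightarrow> 'a) \<Rightarrow> (nat \<Rightarrow> 'a)) \<Rightarrow>
   (real fps, nat \<Rightarrow> 'a) module" where
  "deformed A st =
     \<lparr>carrier = hseries (carrier A),
      mult = st, one = hmonom A 0 \<one>\<^bsub>A\<^esub>,
      zero = (\<lambda>k. \<zero>\<^bsub>A\<^esub>), add = (\<lambda>a b k. a k \<oplus>\<^bsub>A\<^esub> b k),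
      smult = (\<lambda>r a k. \<Oplus>\<^bsub>A\<^esub>i\<in>{..k}. complex_of_real (fps_nth r i) \<odot>\<^bsub>A\<^esub> a (k - i))\<rparr>"

locale star_product = whitney_poisson A br
  for A :: "(complex, 'a) module" (structure) and br +
  fixes st :: "(nat \<Rightarrow> 'a) \<Rightarrow> (nat \<Rightarrow> 'a) \<Rightarrow> (nat \<Rightarrow> 'a)"
  assumes star_assoc:
      "\<lbrakk>a \<in> hseries (carrier A); b \<in> hseries (carrier A); c \<in> hseries (carrier A)\<rbrakk> \<Longrightarrow>
       st (st a b) c = st a (st b c)"
    and star_linear: "bilinear_over UNIV (deformed A st) st"
    and star_continuous_right:
      "\<lbrakk>a \<in> hseries (carrier A); b \<in> hseries (carrier A)\<rbrakk> \<Longrightarrow>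
       \<forall>n. \<exists>m. \<forall>b'\<in>hseries (carrier A). hcong m b b' \<longrightarrow> hcong n (st a b) (st a b')"
    and star_continuous_left:
      "\<lbrakk>a \<in> hseries (carrier A); b \<in> hseries (carrier A)\<rbrakk> \<Longrightarrow>
       \<forall>n. \<exists>m. \<forall>a'\<in>hseries (carrier A). hcong m a a' \<longrightarrow> hcong n (st a b) (st a' b)"
    and star_expansion:
      "\<exists>c :: nat \<Rightarrow> 'a \<Rightarrow> 'a \<Rightarrow> 'a.
         (\<forall>k. bilinear_over \<real> A (c k)) \<and>
         (\<forall>F\<in>carrier A. \<forall>G\<in>carrier A. c 0 F G = F \<otimes> G) \<and>
         (\<forall>F\<in>carrier A. \<forall>G\<in>carrier A. st (hmonom A 0 F) (hmonom A 0 G) = (\<lambda>k. c k F G))"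
    and star_unit:
      "F \<in> carrier A \<Longrightarrow> st (hmonom A 0 \<one>) (hmonom A 0 F) = hmonom A 0 F \<and>
                         st (hmonom A 0 F) (hmonom A 0 \<one>) = hmonom A 0 F"
    and star_commutator:
      "\<lbrakk>F \<in> carrier A; G \<in> carrier A\<rbrakk> \<Longrightarrow>
       hcong 2 (st (hmonom A 0 F) (hmonom A 0 G) \<ominus>\<^bsub>deformed A st\<^esub> st (hmonom A 0 G) (hmonom A 0 F))
               (hmonom A 1 ((- \<i>) \<odot> br F G))"

definition supp :: "('m::topological_space \<Rightarrow> complex) \<Rightarrow> 'm set" where
  "supp f = closure {x. f x \<noteq> 0}"

definition supp_series :: "(nat \<Rightarrow> 'm::topological_space \<Rightarrow> complex) \<Rightarrow> 'm set" where
  "supp_series a = closure {x. \<exists>k. a k x \<noteq> 0}"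

definition local_star_product ::
  "('m::topological_space, 'e::real_normed_vector) chart set \<Rightarrow>
   (('m, 'e) chart \<Rightarrow> 'e \<Rightarrow> ('e \<Rightarrow>\<^sub>L real) \<Rightarrow> ('e \<Rightarrow>\<^sub>L real) \<Rightarrow> real) \<Rightarrow>
   ((nat \<Rightarrow> 'm \<Rightarrow> complex) \<Rightarrow> (nat \<Rightarrow> 'm \<Rightarrow> complex) \<Rightarrow> (nat \<Rightarrow> 'm \<Rightarrow> complex)) \<Rightarrow> bool" where
  "local_star_product atlas P st \<longleftrightarrow>
     (let C = smooth_algebra atlas in
      star_product C (poisson_bracket atlas P) st \<and>
      (\<forall>F\<in>carrier C. \<forall>G\<in>carrier C.
         supp_series (st (hmonom C 0 F) (hmonom C 0 G)) \<subseteq> supp F \<inter> supp G))"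

section \<open>Ideals and exact sequences of algebras\<close>

definition algebra_ideal :: "'a set \<Rightarrow> ('k, 'a) module \<Rightarrow> bool" where
  "algebra_ideal I A \<longleftrightarrow> ideal I A \<and> (\<forall>r. \<forall>a\<in>I. r \<odot>\<^bsub>A\<^esub> a \<in> I)"

text \<open>Homomorphisms of possibly non-unital algebras: the unit of the record is disregarded.\<close>

definition algebra_hom :: "('k, 'a) module \<Rightarrow> ('k, 'b) module \<Rightarrow> ('a \<Rightarrow> 'b) \<Rightarrow> bool" where
  "algebra_hom A B f \<longleftrightarrow>
     f \<in> carrier A \<rightarrow> carrier B \<and>
     (\<forall>a\<in>carrier A. \<forall>b\<in>carrier A.
        f (a \<oplus>\<^bsub>A\<^esub> b) = f a \<oplus>\<^bsub>B\<^esub> f b \<and> f (a \<otimes>\<^bsub>A\<^esub> b) = f a \<otimes>\<^bsub>B\<^esub> f b) \<and>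
     (\<forall>r. \<forall>a\<in>carrier A. f (r \<odot>\<^bsub>A\<^esub> a) = r \<odot>\<^bsub>B\<^esub> f a)"

definition short_exact ::
  "('k, 'a) module \<Rightarrow> ('k, 'b) module \<Rightarrow> ('k, 'c) module \<Rightarrow> ('a \<Rightarrow> 'b) \<Rightarrow> ('b \<Rightarrow> 'c) \<Rightarrow> bool" where
  "short_exact A B C f g \<longleftrightarrow>
     algebra_hom A B f \<and> algebra_hom B C g \<and>
     inj_on f (carrier A) \<and> f ` carrier A = a_kernel B C g \<and> g ` carrier B = carrier C"

definition whitney_projection ::
  "('m, 'e::real_normed_vector) chart set \<Rightarrow> 'm set \<Rightarrow>
   (nat \<Rightarrow> 'm \<Rightarrow> complex) \<Rightarrow> nat \<Rightarrow> ('m \<Rightarrow> complex) set" where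
  "whitney_projection atlas X a = (\<lambda>k. flat_ideal atlas X +>\<^bsub>smooth_algebra atlas\<^esub> a k)"

end

(* Locality makes the cochains of the star product preserve flatness. If f is flat at a point p, choose a
   smooth g that equals f on an open set V and vanishes on an open set W, with p in the closure of both;
   in a chart, g is f times a smooth step function of (y - p) . e / |y - p|^2, which stays smooth at p
   because f is flat there. For a local operator T all derivatives of T f agree with those of T g on V,
   and those of T g vanish on W, so by continuity T f is flat at p. This elementary argument replaces
   Peetre's theorem.

   Hence J[[h]] is an ideal, by linearity over the power series. The bracket is, up to a constant, the
   antisymmetrised first cochain, so it preserves J as well, and everything descends to the quotient. *)

theory Submission
  imports Defs
begin

text \<open>The difficulty is that a cochain is not known to be continuous or differential, so
  approximating a flat function by functions vanishing near p gives nothing. Locality yields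
  information on open sets only, and p may be an isolated point of X; hence two open sets that touch
  p and one smooth g that links them. The quotient (y - p) . e / |y - p|^2, with e a unit vector, is
  at least 1 on the open ball with diameter from p to p + e and negative on a half-space, both
  touching p. Its derivatives are polynomials divided by powers of |y - p|^2, and a flat factor
  absorbs every such power.

  Two further obstacles shape the proof. Flatness on X is tested by global differential operators,
  so a derivative in one chart is accessible only after it is cut off, extended by zero and
  rewritten in every other chart. And the unit, the cochains and the commutator are axiomatised on
  constant series, so facts about them reach arbitrary series by splitting off constant terms,
  multiplication by the formal variable being a shift.\<close>

section \<open>Calculus of smooth maps\<close>

text \<open>Iterated derivatives of order up to \<open>n\<close> are themselves differentiable, which lies between \<open>C\<^sup>n\<close> and
  \<open>C\<^sup>n\<^sup>+\<^sup>1\<close> in finite dimension.\<close>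

primrec Ck_on :: "nat \<Rightarrow> 'e::real_normed_vector set \<Rightarrow> ('e \<Rightarrow> 'b::real_normed_vector) \<Rightarrow> bool" where
  "Ck_on 0 S f \<longleftrightarrow> (\<forall>y\<in>S. f differentiable (at y))"
| "Ck_on (Suc n) S f \<longleftrightarrow> (\<forall>y\<in>S. f differentiable (at y)) \<and>
     (\<forall>v. Ck_on n S (\<lambda>y. frechet_derivative f (at y) v))"

lemma iter_deriv_append: "iter_deriv (us @ vs) f = iter_deriv us (iter_deriv vs f)"
  by (induction us) auto

text \<open>\<open>Ck_on\<close> differentiates f itself first, which suits inductions on the order,
  whereas the head of the list in \<open>iter_deriv\<close> is the outermost derivative. The two
  meet by splitting the list at its end.\<close>

lemma Ck_on_iff_iter_deriv:
  "Ck_on n S f \<longleftrightarrow> (\<forall>vs. length vs \<le> n \<longrightarrow> (\<forall>y\<in>S. iter_deriv vs f differentiable (at y)))"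
proof (induction n arbitrary: f)
  case (Suc n)
  show ?case
  proof
    assume L: "Ck_on (Suc n) S f"
    show "\<forall>vs. length vs \<le> Suc n \<longrightarrow> (\<forall>y\<in>S. iter_deriv vs f differentiable at y)"
    proof (intro allI impI)
      fix vs :: "'a list" assume "length vs \<le> Suc n"
      then show "\<forall>y\<in>S. iter_deriv vs f differentiable at y"
        using L Suc.IH[of "iter_deriv [last vs] f"]
        by (cases vs rule: rev_cases) (auto simp: iter_deriv_append)
    qed
  next
    assume R: "\<forall>vs. length vs \<le> Suc n \<longrightarrow> (\<forall>y\<in>S. iter_deriv vs f differentiable at y)"
    have "Ck_on n S (iter_deriv [v] f)" for v
      unfolding Suc.IH using R by (metis iter_deriv_append length_append_singleton Suc_le_mono)
    moreover have "\<forall>y\<in>S. f differentiable at y"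
      using R[rule_format, of "[]"] by simp
    ultimately show "Ck_on (Suc n) S f" by simp
  qed
qed simp

lemma smooth_on_iff_Ck_on: "smooth_on S f \<longleftrightarrow> (\<forall>n. Ck_on n S f)"
  unfolding smooth_on_def Ck_on_iff_iter_deriv by blast

lemma smooth_onI: "(\<And>n. Ck_on n S f) \<Longrightarrow> smooth_on S f"
  by (simp add: smooth_on_iff_Ck_on)

lemma smooth_on_imp_Ck_on: "smooth_on S f \<Longrightarrow> Ck_on n S f"
  by (simp add: smooth_on_iff_Ck_on)

lemma smooth_on_iter_deriv: "smooth_on S f \<Longrightarrow> smooth_on S (iter_deriv vs f)"
  unfolding smooth_on_def by (metis iter_deriv_append)

lemma smooth_on_subset: "smooth_on S f \<Longrightarrow> T \<subseteq> S \<Longrightarrow> smooth_on T f"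
  unfolding smooth_on_def by blast

lemma smooth_on_differentiable: "smooth_on S f \<Longrightarrow> y \<in> S \<Longrightarrow> f differentiable (at y)"
  unfolding smooth_on_def by (metis iter_deriv.simps(1))

lemma Ck_on_differentiable: "Ck_on n S f \<Longrightarrow> y \<in> S \<Longrightarrow> f differentiable (at y)"
  by (cases n) auto

lemma Ck_on_SucD: "Ck_on (Suc n) S f \<Longrightarrow> Ck_on n S f"
  by (simp add: Ck_on_iff_iter_deriv del: Ck_on.simps)

lemma Ck_on_has_derivative:
  "Ck_on n S f \<Longrightarrow> y \<in> S \<Longrightarrow> (f has_derivative frechet_derivative f (at y)) (at y)"
  using Ck_on_differentiable frechet_derivative_works by blast

text \<open>Holds at points of non-differentiability too: \<open>frechet_derivative\<close> is a
  choice among all derivatives, and both functions have the same ones. So iterated derivatives can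
  be compared without carrying regularity along.\<close>

lemma frechet_derivative_cong_open:
  assumes "open S" "y \<in> S" "\<And>z. z \<in> S \<Longrightarrow> f z = g z"
  shows "frechet_derivative f (at y) = frechet_derivative g (at y)"
proof -
  have "(f has_derivative D) (at y) \<longleftrightarrow> (g has_derivative D) (at y)" for D
    using has_derivative_transform_within_open[of f D y UNIV S g]
      has_derivative_transform_within_open[of g D y UNIV S f] assms by auto
  then show ?thesis unfolding frechet_derivative_def by simp
qed

lemma differentiable_cong_open:
  assumes "open S" "y \<in> S" "\<And>z. z \<in> S \<Longrightarrow> f z = g z"
  shows "f differentiable (at y) \<longleftrightarrow> g differentiable (at y)"
  unfolding differentiable_def
  using has_derivative_transform_within_open[of f _ y UNIV S g]
    has_derivative_transform_within_open[of g _ y UNIV S f] assms by auto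

lemma iter_deriv_cong_open:
  assumes "open S" "y \<in> S" "\<And>z. z \<in> S \<Longrightarrow> f z = g z"
  shows "iter_deriv vs f y = iter_deriv vs g y"
  using assms(2)
proof (induction vs arbitrary: y)
  case (Cons v vs)
  then show ?case
    using frechet_derivative_cong_open[OF assms(1) Cons.prems, of "iter_deriv vs f" "iter_deriv vs g"]
    by simp
qed (use assms in auto)

lemma iter_deriv_differentiable_cong_open:
  assumes "open S" "y \<in> S" "\<And>z. z \<in> S \<Longrightarrow> f z = g z"
  shows "iter_deriv vs f differentiable (at y) \<longleftrightarrow> iter_deriv vs g differentiable (at y)"
  by (intro differentiable_cong_open[OF assms(1,2)] iter_deriv_cong_open[OF assms(1)] assms(3))

lemma smooth_on_cong:
  assumes "open S" "\<And>z. z \<in> S \<Longrightarrow> f z = g z" "smooth_on S f"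
  shows "smooth_on S g"
  using assms(3) iter_deriv_differentiable_cong_open[of S _ f g] assms(1,2)
  unfolding smooth_on_def by blast

lemma Ck_on_cong:
  assumes "open S" "\<And>z. z \<in> S \<Longrightarrow> f z = g z" "Ck_on n S f"
  shows "Ck_on n S g"
  using assms(3) iter_deriv_differentiable_cong_open[of S _ f g] assms(1,2)
  unfolding Ck_on_iff_iter_deriv by blast

lemma smooth_on_local:
  assumes "\<And>y. y \<in> S \<Longrightarrow> \<exists>T g. open T \<and> y \<in> T \<and> smooth_on T g \<and> (\<forall>z\<in>T. f z = g z)"
  shows "smooth_on S f"
  unfolding smooth_on_def
proof (intro allI ballI)
  fix vs y assume "y \<in> S"
  then obtain T g where T: "open T" "y \<in> T" "smooth_on T g" "\<forall>z\<in>T. f z = g z"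
    using assms by blast
  have "smooth_on T f" by (rule smooth_on_cong[OF T(1) _ T(3)]) (use T(4) in auto)
  then show "iter_deriv vs f differentiable at y" using T(2) unfolding smooth_on_def by blast
qed

text \<open>Replaces the chosen \<open>frechet_derivative\<close> by an explicit formula valid on S
  only; since S is open, the higher derivatives do not notice the difference.\<close>

lemma Ck_on_SucI:
  assumes "open S" "\<And>y. y \<in> S \<Longrightarrow> (f has_derivative f' y) (at y)"
    and "\<And>v. Ck_on n S (\<lambda>y. f' y v)"
  shows "Ck_on (Suc n) S f"
proof -
  have "frechet_derivative f (at y) = f' y" if "y \<in> S" for y
    using frechet_derivative_at assms(2) that by metis
  then have "Ck_on n S (\<lambda>y. frechet_derivative f (at y) v)" for v
    by (intro Ck_on_cong[OF assms(1) _ assms(3)[of v]]) auto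
  then show ?thesis using assms(2) by (auto simp: differentiable_def)
qed

section \<open>Closure properties of differentiability up to a given order\<close>

lemma Ck_on_const: "open S \<Longrightarrow> Ck_on n S (\<lambda>y. c)"
proof (induction n arbitrary: c)
  case (Suc n)
  show ?case by (rule Ck_on_SucI[where f'="\<lambda>_ _. 0"]) (use Suc in auto)
qed simp

lemma Ck_on_bounded_linear:
  assumes "bounded_linear f" "open S" shows "Ck_on n S f"
proof (cases n)
  case 0 then show ?thesis
    using assms bounded_linear_imp_differentiable by auto
next
  case (Suc m)
  show ?thesis unfolding Suc
    by (rule Ck_on_SucI[where f'="\<lambda>_. f"])
      (use assms in \<open>auto intro: bounded_linear_imp_has_derivative Ck_on_const\<close>)
qed

lemma Ck_on_add:
  "open S \<Longrightarrow> Ck_on n S f \<Longrightarrow> Ck_on n S g \<Longrightarrow> Ck_on n S (\<lambda>y. f y + g y)"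
proof (induction n arbitrary: f g)
  case (Suc n)
  show ?case
    by (rule Ck_on_SucI[where f'="\<lambda>y v. frechet_derivative f (at y) v + frechet_derivative g (at y) v"])
      (use Suc in \<open>auto intro!: has_derivative_add simp flip: frechet_derivative_works\<close>)
qed auto

lemma Ck_on_sum:
  "open S \<Longrightarrow> (\<And>i. i \<in> I \<Longrightarrow> Ck_on n S (f i)) \<Longrightarrow> Ck_on n S (\<lambda>y. \<Sum>i\<in>I. f i y)"
  by (induction I rule: infinite_finite_induct) (auto intro: Ck_on_add Ck_on_const)

lemma (in bounded_bilinear) Ck_on:
  "open S \<Longrightarrow> Ck_on n S f \<Longrightarrow> Ck_on n S g \<Longrightarrow> Ck_on n S (\<lambda>y. prod (f y) (g y))"
proof (induction n arbitrary: f g)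
  case 0
  then show ?case using FDERIV by (auto simp: differentiable_def) blast
next
  case (Suc n)
  note n = Ck_on_SucD[OF Suc.prems(2)] Ck_on_SucD[OF Suc.prems(3)]
  show ?case
    by (rule Ck_on_SucI[where f'="\<lambda>y v. prod (f y) (frechet_derivative g (at y) v) +
        prod (frechet_derivative f (at y) v) (g y)"])
      (use Suc n in \<open>auto intro!: FDERIV Ck_on_add simp flip: frechet_derivative_works\<close>)
qed

lemmas Ck_on_mult = bounded_bilinear.Ck_on[OF bounded_bilinear_mult]
lemmas Ck_on_scaleR = bounded_bilinear.Ck_on[OF bounded_bilinear_scaleR]
lemmas Ck_on_inner = bounded_bilinear.Ck_on[OF bounded_bilinear_inner]

lemma Ck_on_diff:
  assumes "open S" "Ck_on n S f" "Ck_on n S g" shows "Ck_on n S (\<lambda>y. f y - g y)"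
  using Ck_on_add[OF assms(1,2) Ck_on_scaleR[OF assms(1) Ck_on_const[OF assms(1), of n "-1"] assms(3)]]
  by simp

lemma Ck_on_inverse:
  fixes g :: "'e::real_normed_vector \<Rightarrow> real"
  shows "open S \<Longrightarrow> Ck_on n S g \<Longrightarrow> (\<And>y. y \<in> S \<Longrightarrow> g y \<noteq> 0) \<Longrightarrow> Ck_on n S (\<lambda>y. inverse (g y))"
proof (induction n)
  case 0
  then show ?case by auto
next
  case (Suc n)
  note n = Suc.IH[OF Suc.prems(1) Ck_on_SucD[OF Suc.prems(2)] Suc.prems(3)]
  have d: "Ck_on n S (\<lambda>y. frechet_derivative g (at y) v)" for v using Suc.prems(2) by simp
  show ?case
  proof (rule Ck_on_SucI[OF Suc.prems(1)])
    show "((\<lambda>y. inverse (g y)) has_derivative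
        (\<lambda>v. - (inverse (g y) * frechet_derivative g (at y) v * inverse (g y)))) (at y)"
      if "y \<in> S" for y
      using Ck_on_has_derivative[OF Suc.prems(2) that] Suc.prems(3)[OF that]
      by (auto intro!: derivative_eq_intros)
    show "Ck_on n S (\<lambda>y. - (inverse (g y) * frechet_derivative g (at y) v * inverse (g y)))" for v
      using Ck_on_mult[OF Suc.prems(1) Ck_on_const[OF Suc.prems(1), of n "-1"]
          Ck_on_mult[OF Suc.prems(1) Ck_on_mult[OF Suc.prems(1) n d] n]] by simp
  qed
qed

text \<open>A substitute for \<open>Basis\<close>, as \<open>euclidean_space\<close> excludes dimension zero. Only the expansion property of an
  orthonormal basis is needed.\<close>

definition parseval_frame :: "'c::real_inner set \<Rightarrow> bool" where
  "parseval_frame B \<longleftrightarrow> finite B \<and> (\<forall>x. (\<Sum>b\<in>B. (x \<bullet> b) *\<^sub>R b) = x)"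

lemma parseval_frameD: "parseval_frame B \<Longrightarrow> (\<Sum>b\<in>B. (x \<bullet> b) *\<^sub>R b) = x"
  by (simp add: parseval_frame_def)

lemma parseval_frame_exists:
  assumes "finite (A::'c::real_inner set)" "span A = UNIV"
  shows "\<exists>B::'c set. parseval_frame B"
proof -
  obtain C :: "'c set" where C: "finite C" "span C = UNIV" "pairwise orthogonal C"
    using basis_orthogonal[OF assms(1)] assms(2) by auto
  \<comment> \<open>The orthogonal set may contain 0, which cannot be normalised. In dimension zero
    the resulting frame is empty.\<close>
  define B where "B = (\<lambda>x. x /\<^sub>R norm x) ` (C - {0})"
  have *: "x \<in> span B" if "x \<in> C" for x
  proof (cases "x = 0")
    case False
    then have "x /\<^sub>R norm x \<in> B" using that unfolding B_def by blast
    from span_mul[OF span_base[OF this], of "norm x"] False show ?thesis by simp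
  qed (simp add: span_zero)
  then have "span C \<subseteq> span B" by (intro span_minimal) auto
  then have "span B = UNIV" using C(2) by auto
  moreover have "pairwise orthogonal B"
    using C(3) unfolding B_def pairwise_def orthogonal_def by auto
  moreover have "norm i = 1" if i: "i \<in> B" for i
  proof -
    obtain x where "i = x /\<^sub>R norm x" "x \<noteq> 0" using i unfolding B_def by blast
    then show ?thesis by simp
  qed
  moreover have "finite B" unfolding B_def using C(1) by auto
  ultimately show ?thesis
    unfolding parseval_frame_def using orthonormal_basis_expand[of B] by auto
qed

lemma parseval_frame_real: "parseval_frame {1::real}"
  by (simp add: parseval_frame_def)

text \<open>Expanding the inner derivative in the frame turns the chain rule into a finite sum of
  scalar functions times composites of partial derivatives of f with g, a form on which induction on
  the order can act.\<close>

lemma has_derivative_compose_frame: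
  fixes g :: "'a::real_normed_vector \<Rightarrow> 'c::real_inner" and B :: "'c set" and f :: "'c \<Rightarrow> 'b::real_normed_vector"
  assumes B: "parseval_frame B" and "g differentiable (at y)" "f differentiable (at (g y))"
  shows "((\<lambda>y. f (g y)) has_derivative
      (\<lambda>v. \<Sum>b\<in>B. (frechet_derivative g (at y) v \<bullet> b) *\<^sub>R frechet_derivative f (at (g y)) b)) (at y)"
proof -
  have f: "(f has_derivative frechet_derivative f (at (g y))) (at (g y))"
    and g: "(g has_derivative frechet_derivative g (at y)) (at y)"
    using assms frechet_derivative_works by blast+
  have lin: "linear (frechet_derivative f (at (g y)))" using f has_derivative_linear by blast
  have *: "frechet_derivative f (at (g y)) w =
    (\<Sum>b\<in>B. (w \<bullet> b) *\<^sub>R frechet_derivative f (at (g y)) b)" for w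
  proof -
    have "frechet_derivative f (at (g y)) w =
        frechet_derivative f (at (g y)) (\<Sum>b\<in>B. (w \<bullet> b) *\<^sub>R b)"
      by (simp only: parseval_frameD[OF B])
    also have "\<dots> = (\<Sum>b\<in>B. (w \<bullet> b) *\<^sub>R frechet_derivative f (at (g y)) b)"
      by (simp add: linear_sum[OF lin] linear_cmul[OF lin])
    finally show ?thesis .
  qed
  have eq: "frechet_derivative f (at (g y)) \<circ> frechet_derivative g (at y) =
    (\<lambda>v. \<Sum>b\<in>B. (frechet_derivative g (at y) v \<bullet> b) *\<^sub>R frechet_derivative f (at (g y)) b)"
    by (intro ext, unfold o_def, rule *)
  show ?thesis using diff_chain_at[OF g f] unfolding eq by (simp add: o_def)
qed

text \<open>Each term of the chain rule contains a partial derivative of f, of one order less,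
  composed with the same g; hence only f varies in the induction.\<close>

lemma Ck_on_compose:
  fixes g :: "'a::real_normed_vector \<Rightarrow> 'c::real_inner" and B :: "'c set" and f :: "'c \<Rightarrow> 'b::real_normed_vector"
  assumes B: "parseval_frame B"
  shows "open S \<Longrightarrow> open T \<Longrightarrow> Ck_on n T f \<Longrightarrow> Ck_on n S g \<Longrightarrow> g ` S \<subseteq> T \<Longrightarrow>
    Ck_on n S (\<lambda>y. f (g y))"
proof (induction n arbitrary: f)
  case 0
  then show ?case
    using differentiable_chain_at[of g _ f] by (auto simp: o_def image_subset_iff)
next
  case (Suc n)
  have D: "((\<lambda>y. f (g y)) has_derivative
      (\<lambda>v. \<Sum>b\<in>B. (frechet_derivative g (at y) v \<bullet> b) *\<^sub>R frechet_derivative f (at (g y)) b)) (at y)"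
    if "y \<in> S" for y
    by (rule has_derivative_compose_frame[OF B Ck_on_differentiable[OF Suc.prems(4) that]
          Ck_on_differentiable[OF Suc.prems(3)]]) (use Suc.prems(5) that in auto)
  show ?case
  proof (rule Ck_on_SucI[OF Suc.prems(1) D])
    fix v
    have "Ck_on n S (\<lambda>y. frechet_derivative f (at (g y)) b)" for b
      using Suc.IH[of "\<lambda>y. frechet_derivative f (at y) b", OF Suc.prems(1,2) _ Ck_on_SucD[OF Suc.prems(4)]]
        Suc.prems(3,5) by simp
    then show "Ck_on n S (\<lambda>y. \<Sum>b\<in>B. (frechet_derivative g (at y) v \<bullet> b) *\<^sub>R
        frechet_derivative f (at (g y)) b)"
      using Suc.prems by (auto intro!: Ck_on_sum Ck_on_scaleR Ck_on_inner Ck_on_const)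
  qed
qed

lemma smooth_on_compose:
  fixes g :: "'a::real_normed_vector \<Rightarrow> 'c::real_inner" and B :: "'c set"
  assumes "parseval_frame B" "open S" "open T" "smooth_on T f" "smooth_on S g" "g ` S \<subseteq> T"
  shows "smooth_on S (\<lambda>y. f (g y))"
  using Ck_on_compose[OF assms(1-3) smooth_on_imp_Ck_on[OF assms(4)] smooth_on_imp_Ck_on[OF assms(5)] assms(6)]
  by (rule smooth_onI)

text \<open>For the single points where explicit differentiation breaks down:
  \<open>exp_tail\<close> at 0, and the product of a flat function with the step function at
  p.\<close>

lemma has_derivative_zero_of_quadratic_bound:
  fixes f :: "'a::real_normed_vector \<Rightarrow> 'b::real_normed_vector"
  assumes "f p = 0" "\<delta> > 0" "\<And>y. norm (y - p) < \<delta> \<Longrightarrow> norm (f y) \<le> C * norm (y - p) ^ 2"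
  shows "(f has_derivative (\<lambda>_. 0)) (at p)"
  unfolding has_derivative_at_alt
proof (intro conjI allI impI)
  fix e :: real assume e: "e > 0"
  \<comment> \<open>The summand 1 keeps the quotient meaningful when C = 0.\<close>
  have "norm (f y - f p - 0) \<le> e * norm (y - p)" if y: "norm (y - p) < min \<delta> (e / (\<bar>C\<bar> + 1))" for y
  proof -
    have "norm (y - p) * (\<bar>C\<bar> + 1) \<le> e"
      using y by (simp add: pos_less_divide_eq)
    then have "C * norm (y - p) \<le> e"
      by (smt (verit) abs_ge_self mult.commute mult_right_mono norm_ge_zero)
    then have "C * norm (y - p) ^ 2 \<le> e * norm (y - p)"
      by (simp add: power2_eq_square mult_right_mono flip: mult.assoc)
    with assms(3)[of y] assms(1) y show ?thesis by simp
  qed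
  then show "\<exists>d>0. \<forall>y. norm (y - p) < d \<longrightarrow> norm (f y - f p - 0) \<le> e * norm (y - p)"
    using e assms(2) by (intro exI[of _ "min \<delta> (e / (\<bar>C\<bar> + 1))"]) auto
qed simp

section \<open>A smooth step function\<close>

definition exp_tail :: "nat \<Rightarrow> real \<Rightarrow> real" where
  "exp_tail m t = (if t \<le> 0 then 0 else inverse t ^ m * exp (- inverse t))"

text \<open>With s = 1/t, a single term of the exponential series gives s^(m+2) / (m+2)! \<le> exp
  s. The two surplus powers of s become the factor t^2 that forces a vanishing derivative at
  0.\<close>

lemma exp_tail_le: "exp_tail m t \<le> fact (m + 2) * t\<^sup>2"
proof (cases "t \<le> 0")
  case False
  define s where "s = inverse t"
  have s: "s > 0" "t = inverse s" using False by (auto simp: s_def)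
  have "s ^ (m + 2) / fact (m + 2) \<le> exp s"
  proof -
    have "(\<Sum>i\<in>{m+2}. s ^ i /\<^sub>R fact i) \<le> (\<Sum>i. s ^ i /\<^sub>R fact i)"
      using s summable_exp_generic[of s] by (intro sum_le_suminf) auto
    then show ?thesis by (simp add: exp_def field_simps)
  qed
  then have "s ^ m * s\<^sup>2 \<le> fact (m + 2) * exp s"
    by (simp add: field_simps power_add power2_eq_square del: fact_Suc)
  then have "s ^ m * exp (- s) \<le> fact (m + 2) * inverse s ^ 2"
    using s by (simp add: exp_minus field_simps del: fact_Suc)
  then show ?thesis using s False by (simp add: exp_tail_def del: fact_Suc)
qed (simp add: exp_tail_def)

lemma exp_tail_nonneg: "exp_tail m t \<ge> 0"
  by (simp add: exp_tail_def)

text \<open>The parameter m exists for this lemma: differentiating exp(-1/t) produces powers of 1/t,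
  and with them the family is closed under derivatives up to linear combinations.\<close>

lemma exp_tail_has_derivative:
  "(exp_tail m has_real_derivative (exp_tail (m + 2) t - m * exp_tail (Suc m) t)) (at t)"
proof (cases t "0::real" rule: linorder_cases)
  case less
  have "((\<lambda>_. 0) has_real_derivative 0) (at t)" by simp
  then have "(exp_tail m has_real_derivative 0) (at t)"
    by (rule has_field_derivative_transform_within_open[OF _ open_lessThan[of 0]])
      (use less in \<open>auto simp: exp_tail_def\<close>)
  then show ?thesis using less by (simp add: exp_tail_def)
next
  case equal
  have "(exp_tail m has_derivative (\<lambda>_. 0)) (at 0)"
    by (rule has_derivative_zero_of_quadratic_bound[where \<delta>=1 and C="fact (m + 2)"])
      (use exp_tail_le[of m] exp_tail_nonneg[of m] in \<open>auto simp: exp_tail_def simp del: fact_Suc\<close>)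
  then show ?thesis using equal by (simp add: exp_tail_def has_field_derivative_def lambda_zero)
next
  case greater
  have "((\<lambda>t. inverse t ^ m * exp (- inverse t)) has_real_derivative
      (m * inverse t ^ (m - 1) * (- (inverse t * inverse t)) * exp (- inverse t) +
       inverse t ^ m * (exp (- inverse t) * (inverse t * inverse t)))) (at t)"
    using greater by (auto intro!: derivative_eq_intros)
  \<comment> \<open>The exponent m - 1 is truncated at m = 0, where the factor m kills the term;
    hence the case split.\<close>
  moreover have "m * inverse t ^ (m - 1) * (- (inverse t * inverse t)) * exp (- inverse t) +
       inverse t ^ m * (exp (- inverse t) * (inverse t * inverse t)) =
       exp_tail (m + 2) t - m * exp_tail (Suc m) t"
    using greater by (cases m) (simp_all add: exp_tail_def algebra_simps del: inverse_mult_distrib)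
  ultimately have "((\<lambda>t. inverse t ^ m * exp (- inverse t)) has_real_derivative
      (exp_tail (m + 2) t - m * exp_tail (Suc m) t)) (at t)" by simp
  then show ?thesis
    by (rule has_field_derivative_transform_within_open[OF _ open_greaterThan[of 0]])
      (use greater in \<open>auto simp: exp_tail_def\<close>)
qed

lemma Ck_on_exp_tail: "Ck_on n UNIV (exp_tail m)"
proof (induction n arbitrary: m)
  case 0
  then show ?case
    using has_field_derivative_imp_has_derivative[OF exp_tail_has_derivative]
    by (auto simp: differentiable_def)
next
  case (Suc n)
  show ?case
    by (rule Ck_on_SucI[OF _ has_field_derivative_imp_has_derivative[OF exp_tail_has_derivative]])
      (use Suc in \<open>auto intro!: Ck_on_mult Ck_on_diff Ck_on_const\<close>)
qed

lemma smooth_step_exists: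
  obtains h :: "real \<Rightarrow> real"
  where "smooth_on UNIV h" "\<And>t. t \<le> 0 \<Longrightarrow> h t = 0" "\<And>t. t \<ge> 1 \<Longrightarrow> h t = 1"
proof
  let ?d = "\<lambda>t. exp_tail 0 t + exp_tail 0 (1 - t)"
  let ?h = "\<lambda>t. exp_tail 0 t * inverse (?d t)"
  \<comment> \<open>t and 1 - t are never both nonpositive, so one summand is positive.\<close>
  have "?d t > 0" for t by (auto simp: exp_tail_def intro: add_pos_pos add_pos_nonneg)
  then have d0: "?d t \<noteq> 0" for t by (metis less_irrefl)
  have 1: "Ck_on n UNIV (\<lambda>t::real. exp_tail 0 (1 - t))" for n
    by (rule Ck_on_compose[OF parseval_frame_real _ _ Ck_on_exp_tail])
      (auto intro!: Ck_on_diff Ck_on_const Ck_on_bounded_linear[OF bounded_linear_ident])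
  show "smooth_on UNIV ?h"
    by (intro smooth_onI Ck_on_mult Ck_on_inverse Ck_on_add Ck_on_exp_tail 1 d0) auto
  show "?h t = 0" if "t \<le> 0" for t using that by (simp add: exp_tail_def)
  show "?h t = 1" if "t \<ge> 1" for t using that by (simp add: exp_tail_def)
qed

section \<open>Flat functions\<close>

lemma iter_deriv_add:
  assumes "open S" "y \<in> S" "smooth_on S f" "smooth_on S g"
  shows "iter_deriv l (\<lambda>y. f y + g y) y = iter_deriv l f y + iter_deriv l g y"
  using assms(2)
proof (induction l arbitrary: y)
  case (Cons v l)
  have d: "iter_deriv l f differentiable (at y)" "iter_deriv l g differentiable (at y)"
    using assms(3,4) Cons.prems unfolding smooth_on_def by blast+
  have "frechet_derivative (iter_deriv l (\<lambda>y. f y + g y)) (at y) =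
      frechet_derivative (\<lambda>y. iter_deriv l f y + iter_deriv l g y) (at y)"
    by (rule frechet_derivative_cong_open[OF assms(1) Cons.prems Cons.IH])
  also have "\<dots> = (\<lambda>v. frechet_derivative (iter_deriv l f) (at y) v + frechet_derivative (iter_deriv l g) (at y) v)"
    using d by (intro frechet_derivative_at[symmetric] has_derivative_add)
      (simp_all flip: frechet_derivative_works)
  finally show ?case by simp
qed simp

lemma smooth_on_add:
  "open S \<Longrightarrow> smooth_on S f \<Longrightarrow> smooth_on S g \<Longrightarrow> smooth_on S (\<lambda>y. f y + g y)"
  by (simp add: smooth_on_iff_Ck_on Ck_on_add)

lemma smooth_on_const: "open S \<Longrightarrow> smooth_on S (\<lambda>y. c)"
  by (simp add: smooth_on_iff_Ck_on Ck_on_const)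

lemma smooth_on_bounded_linear: "bounded_linear f \<Longrightarrow> open S \<Longrightarrow> smooth_on S f"
  by (simp add: smooth_on_iff_Ck_on Ck_on_bounded_linear)

lemma (in bounded_bilinear) smooth_on:
  "open S \<Longrightarrow> smooth_on S f \<Longrightarrow> smooth_on S g \<Longrightarrow> smooth_on S (\<lambda>y. prod (f y) (g y))"
  by (simp add: smooth_on_iff_Ck_on Ck_on)

lemmas smooth_on_mult = bounded_bilinear.smooth_on[OF bounded_bilinear_mult]
lemmas smooth_on_scaleR = bounded_bilinear.smooth_on[OF bounded_bilinear_scaleR]
lemmas smooth_on_inner = bounded_bilinear.smooth_on[OF bounded_bilinear_inner]

lemma smooth_on_diff:
  "open S \<Longrightarrow> smooth_on S f \<Longrightarrow> smooth_on S g \<Longrightarrow> smooth_on S (\<lambda>y. f y - g y)"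
  by (simp add: smooth_on_iff_Ck_on Ck_on_diff)

lemma smooth_on_frechet_derivative:
  "smooth_on S f \<Longrightarrow> smooth_on S (\<lambda>y. frechet_derivative f (at y) v)"
  using smooth_on_iter_deriv[of S f "[v]"] by simp

definition flat_at :: "'e::real_normed_vector \<Rightarrow> ('e \<Rightarrow> 'b::real_normed_vector) \<Rightarrow> bool" where
  "flat_at p f \<longleftrightarrow> (\<forall>l. iter_deriv l f p = 0)"

lemma flat_atD: "flat_at p f \<Longrightarrow> f p = 0"
  unfolding flat_at_def by (metis iter_deriv.simps(1))

lemma flat_at_frechet_derivative:
  "flat_at p f \<Longrightarrow> flat_at p (\<lambda>y. frechet_derivative f (at y) v)"
  unfolding flat_at_def
proof
  fix l assume "\<forall>l. iter_deriv l f p = 0"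
  from this[rule_format, of "l @ [v]"] show "iter_deriv l (\<lambda>y. frechet_derivative f (at y) v) p = 0"
    by (simp add: iter_deriv_append)
qed

lemma flat_at_add:
  assumes "open S" "p \<in> S" "smooth_on S f" "smooth_on S g" "flat_at p f" "flat_at p g"
  shows "flat_at p (\<lambda>y. f y + g y)"
  using assms iter_deriv_add[OF assms(1-4)] unfolding flat_at_def by simp

lemma flat_at_zero: "flat_at p (\<lambda>y. 0)"
proof -
  have "iter_deriv l (\<lambda>y. 0) = (\<lambda>y. 0)" for l :: "'a list"
    by (induction l) (simp_all add: frechet_derivative_const)
  then show ?thesis unfolding flat_at_def by metis
qed

text \<open>Avoids the general Leibniz formula: the innermost derivative is peeled off the end of
  the list, and each of the two resulting products still has a flat left factor.\<close>

lemma (in bounded_bilinear) flat_at_left: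
  assumes "open S" "p \<in> S" "smooth_on S f" "smooth_on S g" "flat_at p f"
  shows "flat_at p (\<lambda>y. prod (f y) (g y))"
  unfolding flat_at_def
proof
  fix l show "iter_deriv l (\<lambda>y. prod (f y) (g y)) p = 0"
    using assms(3-5)
  proof (induction l arbitrary: f g rule: rev_induct)
    case Nil
    then show ?case using flat_atD[of p f] by (simp add: zero_left)
  next
    case (snoc v l)
    let ?f = "\<lambda>y. frechet_derivative f (at y) v" and ?g = "\<lambda>y. frechet_derivative g (at y) v"
    have sm: "smooth_on S ?f" "smooth_on S ?g"
      using snoc.prems smooth_on_frechet_derivative by blast+
    have "frechet_derivative (\<lambda>y. prod (f y) (g y)) (at y) v = prod (f y) (?g y) + prod (?f y) (g y)"
      if "y \<in> S" for y
    proof -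
      have "((\<lambda>y. prod (f y) (g y)) has_derivative (\<lambda>v. prod (f y) (frechet_derivative g (at y) v) +
          prod (frechet_derivative f (at y) v) (g y))) (at y)"
        using smooth_on_differentiable[OF snoc.prems(1) that] smooth_on_differentiable[OF snoc.prems(2) that]
        by (intro FDERIV) (simp_all flip: frechet_derivative_works)
      from frechet_derivative_at[OF this] show ?thesis by metis
    qed
    from iter_deriv_cong_open[OF assms(1,2) this, where vs=l]
    have "iter_deriv (l @ [v]) (\<lambda>y. prod (f y) (g y)) p =
        iter_deriv l (\<lambda>y. prod (f y) (?g y) + prod (?f y) (g y)) p"
      by (simp add: iter_deriv_append)
    also have "\<dots> = iter_deriv l (\<lambda>y. prod (f y) (?g y)) p + iter_deriv l (\<lambda>y. prod (?f y) (g y)) p"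
      by (intro iter_deriv_add[OF assms(1,2)] smooth_on assms(1) sm snoc.prems)
    also have "\<dots> = 0"
      using snoc.IH[OF snoc.prems(1) sm(2) snoc.prems(3)]
        snoc.IH[OF sm(1) snoc.prems(2) flat_at_frechet_derivative[OF snoc.prems(3)]] by simp
    finally show ?case .
  qed
qed

lemma (in bounded_bilinear) flat_at_right:
  assumes "open S" "p \<in> S" "smooth_on S f" "smooth_on S g" "flat_at p g"
  shows "flat_at p (\<lambda>y. prod (f y) (g y))"
  using bounded_bilinear.flat_at_left[OF flip assms(1,2,4,3,5)] .

lemmas flat_at_scaleR = bounded_bilinear.flat_at_right[OF bounded_bilinear_scaleR]
lemmas flat_at_mult_left = bounded_bilinear.flat_at_left[OF bounded_bilinear_mult]

text \<open>Taylor's estimate for a flat function, by the mean value inequality and induction on the order.\<close>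

lemma flat_at_bound:
  fixes p :: "'e::real_inner" and B :: "'e set"
  assumes B: "parseval_frame B" and S: "open S" "p \<in> S"
  shows "smooth_on S f \<Longrightarrow> flat_at p f \<Longrightarrow>
    \<exists>C \<delta>. \<delta> > 0 \<and> ball p \<delta> \<subseteq> S \<and> (\<forall>y\<in>ball p \<delta>. norm (f y) \<le> C * norm (y - p) ^ N)"
proof (induction N arbitrary: f)
  case 0
  have "isCont f p"
    using smooth_on_differentiable[OF 0(1) S(2)] differentiable_imp_continuous_within by blast
  then obtain d where d: "d > 0" "\<forall>y. dist y p < d \<longrightarrow> dist (f y) (f p) < 1"
    unfolding continuous_at_eps_delta by (meson zero_less_one)
  obtain d' where d': "d' > 0" "ball p d' \<subseteq> S" using S open_contains_ball by blast
  have "norm (f y) \<le> 1 * norm (y - p) ^ 0" if "y \<in> ball p (min d d')" for y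
    using d(2)[rule_format, of y] that flat_atD[OF 0(2)] by (simp add: dist_commute)
  moreover have "ball p (min d d') \<subseteq> S" using d'(2) by auto
  ultimately show ?case using d(1) d'(1) by (intro exI[of _ 1] exI[of _ "min d d'"]) simp
next
  case (Suc N)
  define D where "D = (\<lambda>b y. frechet_derivative f (at y) b)"
  have "\<forall>b\<in>B. \<exists>C \<delta>. \<delta> > 0 \<and> ball p \<delta> \<subseteq> S \<and> (\<forall>y\<in>ball p \<delta>. norm (D b y) \<le> C * norm (y - p) ^ N)"
    unfolding D_def
    using Suc.IH Suc.prems smooth_on_frechet_derivative flat_at_frechet_derivative by blast
  then obtain C d where Cd: "\<And>b. b \<in> B \<Longrightarrow> d b > 0"
      "\<And>b y. b \<in> B \<Longrightarrow> y \<in> ball p (d b) \<Longrightarrow> norm (D b y) \<le> C b * norm (y - p) ^ N"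
    by metis
  obtain d0 where d0: "d0 > 0" "ball p d0 \<subseteq> S" using S open_contains_ball by blast
  have fin: "finite B" using B by (simp add: parseval_frame_def)
  \<comment> \<open>Including \<open>d0\<close> keeps the set nonempty when the frame is empty and
    puts the ball inside S.\<close>
  define \<delta> where "\<delta> = Min (insert d0 (d ` B))"
  have \<delta>: "\<delta> > 0" "\<delta> \<le> d0" "\<And>b. b \<in> B \<Longrightarrow> \<delta> \<le> d b"
    unfolding \<delta>_def using fin d0 Cd(1) by auto
  define K where "K = (\<Sum>b\<in>B. norm b * \<bar>C b\<bar>)"
  have "norm (f y) \<le> K * norm (y - p) ^ Suc N" if y: "y \<in> ball p \<delta>" for y
  proof -
    let ?r = "norm (y - p)"
    \<comment> \<open>On this smaller ball the partial derivatives are bounded by a multiple of |y -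
      p|^N, and the mean value inequality supplies the remaining factor |y - p|.\<close>
    have sub: "cball p ?r \<subseteq> ball p \<delta>" using y by (auto simp: dist_norm norm_minus_commute)
    have "norm (f y - f p) \<le> (K * ?r ^ N) * norm (y - p)"
    proof (rule differentiable_bound[where S="cball p ?r" and f'="\<lambda>z. frechet_derivative f (at z)"])
      fix z assume z: "z \<in> cball p ?r"
      then have z\<delta>: "z \<in> ball p \<delta>" using sub by blast
      then have zS: "z \<in> S" using d0 \<delta> by (auto simp: subset_iff)
      have der: "(f has_derivative frechet_derivative f (at z)) (at z)"
        using smooth_on_differentiable[OF Suc.prems(1) zS] frechet_derivative_works by blast
      then show "(f has_derivative frechet_derivative f (at z)) (at z within cball p ?r)"
        by (rule has_derivative_at_withinI)
      have lin: "linear (frechet_derivative f (at z))" using der has_derivative_linear by blast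
      show "onorm (frechet_derivative f (at z)) \<le> K * ?r ^ N"
      proof (rule onorm_bound)
        show "0 \<le> K * ?r ^ N" unfolding K_def by (intro mult_nonneg_nonneg sum_nonneg) auto
      next
        fix v
        have "frechet_derivative f (at z) v = frechet_derivative f (at z) (\<Sum>b\<in>B. (v \<bullet> b) *\<^sub>R b)"
          by (simp only: parseval_frameD[OF B])
        also have "\<dots> = (\<Sum>b\<in>B. (v \<bullet> b) *\<^sub>R D b z)"
          by (simp add: linear_sum[OF lin] linear_cmul[OF lin] D_def)
        also have "norm \<dots> \<le> (\<Sum>b\<in>B. norm v * norm b * (\<bar>C b\<bar> * ?r ^ N))"
        proof (rule sum_norm_le)
          fix b assume b: "b \<in> B"
          have "norm (D b z) \<le> C b * norm (z - p) ^ N" using Cd(2)[OF b] \<delta>(3)[OF b] z\<delta> by auto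
          also have "\<dots> \<le> \<bar>C b\<bar> * norm (z - p) ^ N" by (simp add: mult_right_mono)
          also have "\<dots> \<le> \<bar>C b\<bar> * ?r ^ N"
            using z by (intro mult_left_mono power_mono) (auto simp: dist_norm norm_minus_commute)
          finally have 1: "norm (D b z) \<le> \<bar>C b\<bar> * ?r ^ N" .
          show "norm ((v \<bullet> b) *\<^sub>R D b z) \<le> norm v * norm b * (\<bar>C b\<bar> * ?r ^ N)"
            unfolding norm_scaleR by (intro mult_mono Cauchy_Schwarz_ineq2 1) auto
        qed
        also have "\<dots> = K * ?r ^ N * norm v"
          unfolding K_def by (simp add: sum_distrib_left sum_distrib_right mult_ac)
        finally show "norm (frechet_derivative f (at z) v) \<le> K * ?r ^ N * norm v" .
      qed
    qed (auto simp: dist_norm norm_minus_commute)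
    then show ?thesis using flat_atD[OF Suc.prems(2)] by (simp add: mult_ac)
  qed
  moreover have "ball p \<delta> \<subseteq> S" using d0 \<delta> by (auto simp: subset_iff)
  ultimately show ?case using \<delta>(1) by blast
qed

text \<open>The list \<open>replicate k 1\<close> encodes the k-th ordinary derivative, because a
  linear map on the reals is multiplication by its value at 1.\<close>

lemma smooth_real_has_derivative:
  fixes h :: "real \<Rightarrow> real"
  assumes "smooth_on UNIV h"
  shows "(iter_deriv (replicate k 1) h has_real_derivative iter_deriv (replicate (Suc k) 1) h t) (at t)"
proof -
  let ?D = "iter_deriv (replicate k 1) h"
  have d: "(?D has_derivative frechet_derivative ?D (at t)) (at t)"
    using assms unfolding smooth_on_def frechet_derivative_works by blast
  then have lin: "linear (frechet_derivative ?D (at t))" using has_derivative_linear by blast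
  have eq: "frechet_derivative ?D (at t) = (*) (frechet_derivative ?D (at t) 1)"
  proof
    fix x show "frechet_derivative ?D (at t) x = frechet_derivative ?D (at t) 1 * x"
      using linear_cmul[OF lin, of x 1] by simp
  qed
  have "(?D has_derivative (*) (frechet_derivative ?D (at t) 1)) (at t)"
    by (rule subst[OF eq, where P="\<lambda>X. (?D has_derivative X) (at t)", OF d])
  then show ?thesis by (simp add: has_field_derivative_def)
qed

text \<open>Off [0,1] the function is locally constant; on [0,1] the derivative is bounded by
  compactness.\<close>

lemma smooth_step_derivatives_bounded:
  fixes h :: "real \<Rightarrow> real"
  assumes h: "smooth_on UNIV h" "\<And>t. t \<le> 0 \<Longrightarrow> h t = 0" "\<And>t. t \<ge> 1 \<Longrightarrow> h t = 1"
  shows "\<exists>M. \<forall>t. \<bar>iter_deriv (replicate k 1) h t\<bar> \<le> M"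
proof -
  let ?D = "iter_deriv (replicate k 1) h"
  have "iter_deriv (replicate k 1) (\<lambda>_::real. c) = (\<lambda>_. if k = 0 then c else 0)" for c :: real
    by (induction k) (simp_all add: frechet_derivative_const)
  then have const: "iter_deriv (replicate k 1) (\<lambda>_::real. c) t = (if k = 0 then c else 0)" for c t :: real
    by metis
  have "?D t = (if k = 0 then 0 else 0)" if "t < 0" for t
    using iter_deriv_cong_open[of "{..<0}" t h "\<lambda>_. 0" "replicate k 1"] that h(2) const[of 0 t] by simp
  then have neg: "?D t = 0" if "t < 0" for t using that by simp
  have "?D t = (if k = 0 then 1 else 0)" if "t > 1" for t
    using iter_deriv_cong_open[of "{1<..}" t h "\<lambda>_. 1" "replicate k 1"] that h(3) const[of 1 t] by simp
  then have pos: "\<bar>?D t\<bar> \<le> 1" if "t > 1" for t using that by simp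
  have "continuous_on {0..1} ?D"
    using smooth_real_has_derivative[OF h(1)] by (intro DERIV_continuous_on) (blast intro: DERIV_subset)
  then have "bounded (?D ` {0..1})" by (intro compact_imp_bounded compact_continuous_image) auto
  then obtain M where "\<forall>t\<in>{0..1}. \<bar>?D t\<bar> \<le> M"
    unfolding bounded_iff by auto
  then have M: "\<And>t. t \<in> {0..1} \<Longrightarrow> \<bar>?D t\<bar> \<le> M" by blast
  have "\<bar>?D t\<bar> \<le> max 1 M" for t
    using neg[of t] pos[of t] M[of t] by (cases "t < 0"; cases "t > 1") auto
  then show ?thesis by blast
qed

text \<open>For flat \<open>f\<close> the product with the step function of \<open>((y - p) \<bullet> e) / |y - p|\<^sup>2\<close> stays smooth at \<open>p\<close>:
  the family of functions below is closed under directional derivatives up to sums, and each member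
  is \<open>O(|y - p|\<^sup>2)\<close>.\<close>

lemma Ck_on_flat_times_step:
  fixes p e :: "'e::real_inner" and h :: "real \<Rightarrow> real" and B :: "'e set"
    and f :: "'e \<Rightarrow> 'b::real_normed_vector"
  defines "q \<equiv> \<lambda>y. (y - p) \<bullet> (y - p)"
  defines "s \<equiv> \<lambda>y. ((y - p) \<bullet> e) * inverse (q y)"
  defines "T \<equiv> \<lambda>f k m y. (iter_deriv (replicate k 1) h (s y) * inverse (q y) ^ m) *\<^sub>R f y"
  assumes B: "parseval_frame B" and S: "open S" "p \<in> S"
    and h: "smooth_on UNIV h" "\<And>t. t \<le> 0 \<Longrightarrow> h t = 0" "\<And>t. t \<ge> 1 \<Longrightarrow> h t = 1"
  shows "smooth_on S f \<Longrightarrow> flat_at p f \<Longrightarrow> Ck_on n S (T f k m)"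
proof -
  let ?H = "\<lambda>k. iter_deriv (replicate k 1) h"
  \<comment> \<open>Polynomial factors that arise when the argument s of the step and the m-th power
    of 1/q are differentiated in direction v. They are absorbed into f, which stays smooth and flat,
    so that only k and m change.\<close>
  define c1 where "c1 = (\<lambda>v y. - 2 * ((y - p) \<bullet> e) * ((y - p) \<bullet> v))"
  define c2 where "c2 = (\<lambda>(m::nat) v y. - 2 * real m * ((y - p) \<bullet> v))"
  define f' where "f' = (\<lambda>(f::'e \<Rightarrow> 'b) v y. frechet_derivative f (at y) v)"
  have in1: "smooth_on S (\<lambda>y. (y - p) \<bullet> v)" for v
    by (intro smooth_on_inner smooth_on_diff smooth_on_const
        smooth_on_bounded_linear[OF bounded_linear_ident] S(1))
  have c: "smooth_on S (c1 v)" "smooth_on S (c2 m v)" for m v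
    unfolding c1_def c2_def by (intro smooth_on_mult smooth_on_const S(1) in1)+
  have fl: "smooth_on S (f' f v)" "flat_at p (f' f v)"
      "smooth_on S (\<lambda>y. (v \<bullet> e) *\<^sub>R f y)" "flat_at p (\<lambda>y. (v \<bullet> e) *\<^sub>R f y)"
      "smooth_on S (\<lambda>y. c1 v y *\<^sub>R f y)" "flat_at p (\<lambda>y. c1 v y *\<^sub>R f y)"
      "smooth_on S (\<lambda>y. c2 m v y *\<^sub>R f y)" "flat_at p (\<lambda>y. c2 m v y *\<^sub>R f y)"
    if "smooth_on S f" "flat_at p f" for f :: "'e \<Rightarrow> 'b" and v m
    unfolding f'_def
    by (intro smooth_on_scaleR smooth_on_const smooth_on_frechet_derivative flat_at_frechet_derivative
        flat_at_scaleR[OF S] S c that)+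
  have der: "(T f k m has_derivative (\<lambda>v. T (f' f v) k m y + T (\<lambda>y. (v \<bullet> e) *\<^sub>R f y) (Suc k) (Suc m) y +
      T (\<lambda>y. c1 v y *\<^sub>R f y) (Suc k) (m + 2) y + T (\<lambda>y. c2 m v y *\<^sub>R f y) k (Suc m) y)) (at y)"
    (is "(_ has_derivative ?D) _")
    if f: "smooth_on S f" "flat_at p f" and y: "y \<in> S" for f :: "'e \<Rightarrow> 'b" and k m y
  proof (cases "y = p")
    case True
    \<comment> \<open>The quotient is singular at p, so the derivative there comes from a quadratic
      bound. The claimed derivative vanishes as well, since each of its four terms carries a flat
      function.\<close>
    have T0: "T g k m p = 0" if "flat_at p g" for g k m
      using flat_atD[OF that] by (simp add: T_def)
    obtain M where M: "\<And>t. \<bar>?H k t\<bar> \<le> M" using smooth_step_derivatives_bounded[OF h] by blast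
    \<comment> \<open>Of the order 2m + 2, the part 2m cancels the m-th power of 1/q and leaves the
      square of the distance.\<close>
    obtain C d where Cd: "d > 0" "\<And>y. y \<in> ball p d \<Longrightarrow> norm (f y) \<le> C * norm (y - p) ^ (2 * m + 2)"
      using flat_at_bound[OF B S f, of "2 * m + 2"] by blast
    have "norm (T f k m y) \<le> (M * C) * norm (y - p) ^ 2" if "norm (y - p) < d" for y
    proof (cases "y = p")
      case True then show ?thesis using T0[OF f(2)] by simp
    next
      case False
      let ?r = "norm (y - p)"
      have r: "?r > 0" using False by simp
      have q: "q y = ?r ^ 2" by (simp add: q_def power2_norm_eq_inner)
      have "norm (f y) \<le> C * ?r ^ (2 * m + 2)"
        using that by (intro Cd(2)) (simp add: dist_norm norm_minus_commute)
      then have "norm (T f k m y) \<le> (M * inverse (q y) ^ m) * (C * ?r ^ (2 * m + 2))"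
        unfolding T_def norm_scaleR abs_mult using M[of "s y"] order_trans[OF abs_ge_zero M[of "s y"]] q
        by (intro mult_mono) auto
      also have "\<dots> = (M * C) * ?r ^ 2"
      proof -
        have "inverse ((?r ^ 2) ^ m) * ?r ^ (2 * m + 2) = ?r ^ 2"
          using r by (simp only: power_add power_mult) (simp flip: mult.assoc)
        then show ?thesis unfolding q by (simp add: power_inverse mult_ac)
      qed
      finally show ?thesis .
    qed
    then have "(T f k m has_derivative (\<lambda>_. 0)) (at p)"
      by (intro has_derivative_zero_of_quadratic_bound[OF _ Cd(1)] T0 f(2))
    moreover have "?D = (\<lambda>_. 0)" unfolding True using fl[OF f] by (simp add: T0)
    ultimately show ?thesis using True by simp
  next
    case False
    then have q: "q y \<noteq> 0" by (simp add: q_def)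
    have dq: "(q has_derivative (\<lambda>v. 2 * ((y - p) \<bullet> v))) (at y)"
      unfolding q_def by (auto intro!: derivative_eq_intros simp: inner_commute)
    have diq: "((\<lambda>y. inverse (q y)) has_derivative (\<lambda>v. - (inverse (q y) * (2 * ((y - p) \<bullet> v)) * inverse (q y)))) (at y)"
      by (rule Deriv.has_derivative_inverse[OF q dq])
    have ds: "(s has_derivative (\<lambda>v. ((y - p) \<bullet> e) * - (inverse (q y) * (2 * ((y - p) \<bullet> v)) * inverse (q y)) +
        (v \<bullet> e) * inverse (q y))) (at y)"
      unfolding s_def by (rule has_derivative_mult[OF _ diq]) (auto intro!: derivative_eq_intros)
    have df: "(f has_derivative frechet_derivative f (at y)) (at y)"
      using smooth_on_differentiable[OF f(1) y] frechet_derivative_works by blast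
    have dH: "((\<lambda>y. ?H k (s y)) has_derivative (\<lambda>v. ?H (Suc k) (s y) * 
        (((y - p) \<bullet> e) * - (inverse (q y) * (2 * ((y - p) \<bullet> v)) * inverse (q y)) + (v \<bullet> e) * inverse (q y)))) (at y)"
      using has_derivative_compose[OF ds has_field_derivative_imp_has_derivative[OF
          smooth_real_has_derivative[OF h(1), of k "s y"]]] by simp
    let ?q = "inverse (q y)" and ?Ha = "?H k (s y)" and ?Hb = "?H (Suc k) (s y)"
    define \<alpha> where "\<alpha> = (\<lambda>v. ?Ha * (of_nat m * - (?q * (2 * ((y - p) \<bullet> v)) * ?q) * ?q ^ (m - 1)) +
        ?Hb * (((y - p) \<bullet> e) * - (?q * (2 * ((y - p) \<bullet> v)) * ?q) + (v \<bullet> e) * ?q) * ?q ^ m)"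
    have \<alpha>: "\<alpha> v = ?Hb * ?q ^ Suc m * (v \<bullet> e) + ?Hb * ?q ^ (m + 2) * c1 v y + ?Ha * ?q ^ Suc m * c2 m v y" for v
      by (cases m) (simp_all add: \<alpha>_def c1_def c2_def algebra_simps power2_eq_square)
    have "((\<lambda>y. (?H k (s y) * inverse (q y) ^ m) *\<^sub>R f y) has_derivative
      (\<lambda>v. (?Ha * ?q ^ m) *\<^sub>R frechet_derivative f (at y) v + \<alpha> v *\<^sub>R f y)) (at y)"
      unfolding \<alpha>_def
      by (intro has_derivative_scaleR has_derivative_mult has_derivative_power dH diq df)
    moreover have "(\<lambda>v. (?Ha * ?q ^ m) *\<^sub>R frechet_derivative f (at y) v + \<alpha> v *\<^sub>R f y) = ?D"
      unfolding \<alpha> T_def f'_def by (simp only: scaleR_scaleR scaleR_add_left add.assoc)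
    ultimately show ?thesis unfolding T_def by simp
  qed
  show "smooth_on S f \<Longrightarrow> flat_at p f \<Longrightarrow> Ck_on n S (T f k m)"
  proof (induction n arbitrary: f k m)
    case 0
    show ?case unfolding Ck_on.simps differentiable_def using der[OF 0] by blast
  next
    case (Suc n)
    show ?case
      by (rule Ck_on_SucI[OF S(1) der[OF Suc.prems]], assumption)
        (intro Ck_on_add S(1) Suc.IH fl Suc.prems)
  qed
qed

text \<open>V is the open ball with the segment from p to p + e as diameter and W the open
  half-space behind p. That g vanishes wherever f does lets a cut-off f pass its support on to g, so
  that g can be extended by zero to the manifold.\<close>

lemma flat_at_splitting:
  fixes p :: "'e::real_inner" and B :: "'e set" and f :: "'e \<Rightarrow> 'b::real_normed_vector"
  assumes B: "parseval_frame B" and S: "open S" "p \<in> S" and f: "smooth_on S f" "flat_at p f"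
  obtains g V W where "smooth_on S g" "\<And>y. f y = 0 \<Longrightarrow> g y = 0" "open V" "open W"
    "p \<in> closure V" "p \<in> closure W" "\<And>y. y \<in> V \<Longrightarrow> g y = f y" "\<And>y. y \<in> W \<Longrightarrow> g y = 0"
proof (cases "\<exists>e::'e. e \<noteq> 0")
  case False
  \<comment> \<open>In dimension zero p is the only point, so f = 0 and the whole space serves for
    both V and W.\<close>
  then have triv: "y = p" for y by (metis (full_types))
  show ?thesis
  proof (rule that[of "\<lambda>_. 0" UNIV UNIV])
    show "0 = f y" for y using flat_atD[OF f(2)] triv[of y] by simp
  qed (auto simp: smooth_on_const S)
next
  case True
  then obtain e0 :: 'e where "e0 \<noteq> 0" by blast
  define e where "e = e0 /\<^sub>R norm e0"
  have e: "norm e = 1" using \<open>e0 \<noteq> 0\<close> by (simp add: e_def)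
  then have ee: "e \<bullet> e = 1" by (simp add: norm_eq_1)
  obtain h :: "real \<Rightarrow> real" where h: "smooth_on UNIV h" "\<And>t. t \<le> 0 \<Longrightarrow> h t = 0" "\<And>t. t \<ge> 1 \<Longrightarrow> h t = 1"
    using smooth_step_exists by metis
  define q where "q = (\<lambda>y. (y - p) \<bullet> (y - p))"
  define g where "g = (\<lambda>y. h (((y - p) \<bullet> e) * inverse (q y)) *\<^sub>R f y)"
  define V where "V = {y. q y < (y - p) \<bullet> e}"
  define W where "W = {y. (y - p) \<bullet> e < 0}"
  \<comment> \<open>Approach along a ray: c = 1 stays in V because t^2 < t for 0 < t < 1, and c = -1
    stays in W.\<close>
  have path: "p \<in> closure A" if "\<And>t. 0 < t \<Longrightarrow> t < 1 \<Longrightarrow> p + (c * t) *\<^sub>R e \<in> A" for A and c :: real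
  proof -
    have "((\<lambda>t. p + (c * t) *\<^sub>R e) \<longlongrightarrow> p + (c * 0) *\<^sub>R e) (at_right 0)"
      by (intro tendsto_intros)
    then have lim: "((\<lambda>t. p + (c * t) *\<^sub>R e) \<longlongrightarrow> p) (at_right 0)" by simp
    have "eventually (\<lambda>t. p + (c * t) *\<^sub>R e \<in> closure A) (at_right (0::real))"
      by (rule eventually_at_rightI[of 0 1]) (use that closure_subset in auto)
    then show ?thesis using Lim_in_closed_set[OF closed_closure _ _ lim] by simp
  qed
  show ?thesis
  proof (rule that[of g V W])
    have "Ck_on n S g" for n
      using Ck_on_flat_times_step[OF B S h f, where k=0 and m=0 and e=e] unfolding g_def q_def by simp
    then show "smooth_on S g" by (rule smooth_onI)
    show "g y = 0" if "f y = 0" for y using that by (simp add: g_def)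
    show "open V" "open W"
      unfolding V_def W_def q_def by (intro open_Collect_less continuous_intros)+
    show "p \<in> closure V"
    proof (rule path[of 1])
      fix t :: real assume "0 < t" "t < 1"
      then show "p + (1 * t) *\<^sub>R e \<in> V" by (simp add: V_def q_def ee)
    qed
    show "p \<in> closure W"
      by (rule path[of "-1"]) (simp add: W_def ee)
    show "g y = f y" if "y \<in> V" for y
    proof -
      have "q y > 0 \<or> y = p" by (simp add: q_def)
      with that have "q y > 0" by (auto simp: V_def q_def)
      then have "((y - p) \<bullet> e) * inverse (q y) \<ge> 1" using that by (simp add: V_def field_simps)
      then show ?thesis by (simp add: g_def h(3))
    qed
    show "g y = 0" if "y \<in> W" for y
    proof -
      have "((y - p) \<bullet> e) * inverse (q y) \<le> 0"
        using that by (intro mult_nonpos_nonneg) (auto simp: W_def q_def)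
      then show ?thesis by (simp add: g_def h(2))
    qed
  qed
qed

lemma bump_exists:
  fixes p :: "'e::real_inner"
  assumes "open S" "p \<in> S"
  obtains \<sigma> :: "'e \<Rightarrow> real" and r \<delta> where "smooth_on UNIV \<sigma>" "\<delta> > 0" "cball p r \<subseteq> S"
    "\<And>y. y \<notin> cball p r \<Longrightarrow> \<sigma> y = 0" "\<And>y. y \<in> ball p \<delta> \<Longrightarrow> \<sigma> y = 1"
proof -
  obtain r where r: "r > 0" "cball p r \<subseteq> S" using assms open_contains_cball by blast
  obtain h :: "real \<Rightarrow> real" where h: "smooth_on UNIV h" "\<And>t. t \<le> 0 \<Longrightarrow> h t = 0" "\<And>t. t \<ge> 1 \<Longrightarrow> h t = 1"
    using smooth_step_exists by metis
  \<comment> \<open>The constants make u nonpositive outside the ball of radius r and at least 1 up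
    to distance r / sqrt 2, in particular within r / 2.\<close>
  define u where "u = (\<lambda>y. 2 - 2 * inverse (r\<^sup>2) * ((y - p) \<bullet> (y - p)))"
  have u: "u y = 2 - 2 * (dist p y)\<^sup>2 / r\<^sup>2" for y
    by (simp add: u_def dist_norm norm_minus_commute power2_norm_eq_inner[symmetric] field_simps)
  have "smooth_on UNIV u"
    unfolding u_def
    by (intro smooth_on_diff smooth_on_mult smooth_on_inner smooth_on_const
        smooth_on_bounded_linear[OF bounded_linear_ident] open_UNIV)
  then have "smooth_on UNIV (\<lambda>y. h (u y))"
    by (intro smooth_on_compose[OF parseval_frame_real open_UNIV open_UNIV h(1)]) auto
  moreover have "h (u y) = 0" if "y \<notin> cball p r" for y
  proof (rule h(2))
    have "r\<^sup>2 \<le> (dist p y)\<^sup>2" using that r by (intro power_mono) auto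
    then show "u y \<le> 0" using r(1) by (simp add: u field_simps)
  qed
  moreover have "h (u y) = 1" if "y \<in> ball p (r / 2)" for y
  proof (rule h(3))
    have "(dist p y)\<^sup>2 \<le> (r / 2)\<^sup>2" using that r by (intro power_mono) auto
    then have "4 * (dist p y)\<^sup>2 \<le> r\<^sup>2" by (simp add: power_divide)
    then have "2 * (dist p y)\<^sup>2 \<le> r\<^sup>2" using zero_le_power2[of "dist p y"] by linarith
    then show "u y \<ge> 1" using r(1) by (simp add: u field_simps)
  qed
  ultimately show ?thesis using that[of "\<lambda>y. h (u y)" "r / 2" r] r by auto
qed

section \<open>Flat functions and local operators on a manifold\<close>

text \<open>A differential operator seen from another chart: the coefficients live on S, while g is
  differentiated at the image point. L and the coefficients are quantified before g because
  \<open>differential_operator\<close> asks for one choice serving all functions.\<close>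

definition pullback_operator ::
  "'e set \<Rightarrow> 'e set \<Rightarrow> ('e \<Rightarrow> 'e) \<Rightarrow> nat \<Rightarrow> (('e::real_normed_vector \<Rightarrow> complex) \<Rightarrow> 'e \<Rightarrow> complex) \<Rightarrow> bool"
  where "pullback_operator S T \<tau> n D \<longleftrightarrow>
    (\<exists>L (a :: 'e list \<Rightarrow> 'e \<Rightarrow> complex).
       finite L \<and> (\<forall>l\<in>L. length l \<le> n \<and> smooth_on S (a l)) \<and>
       (\<forall>g. smooth_on T g \<longrightarrow> (\<forall>y\<in>S. D g y = (\<Sum>l\<in>L. a l y * iter_deriv l g (\<tau> y)))))"

lemma pullback_operatorE:
  assumes "pullback_operator S T \<tau> n D"
  obtains L a where "finite L" "\<And>l. l \<in> L \<Longrightarrow> length l \<le> n" "\<And>l. l \<in> L \<Longrightarrow> smooth_on S (a l)"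
    "\<And>g y. smooth_on T g \<Longrightarrow> y \<in> S \<Longrightarrow> D g y = (\<Sum>l\<in>L. a l y * iter_deriv l g (\<tau> y))"
  using assms unfolding pullback_operator_def by blast

lemma pullback_operator_single:
  assumes "length l \<le> n" "smooth_on S c"
  shows "pullback_operator S T \<tau> n (\<lambda>g y. c y * iter_deriv l g (\<tau> y))"
  unfolding pullback_operator_def
  using assms by (intro exI[of _ "{l}"] exI[of _ "\<lambda>_. c"]) auto

lemma pullback_operator_zero: "pullback_operator S T \<tau> n (\<lambda>g y. 0)"
  unfolding pullback_operator_def by (rule exI[of _ "{}"]) simp

lemma pullback_operator_add:
  assumes S: "open S" and "pullback_operator S T \<tau> n D1" "pullback_operator S T \<tau> n D2"
  shows "pullback_operator S T \<tau> n (\<lambda>g y. D1 g y + D2 g y)"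
proof -
  from assms(2) obtain L1 a1 where 1: "finite L1" "\<And>l. l \<in> L1 \<Longrightarrow> length l \<le> n"
    "\<And>l. l \<in> L1 \<Longrightarrow> smooth_on S (a1 l)"
    "\<And>g y. smooth_on T g \<Longrightarrow> y \<in> S \<Longrightarrow> D1 g y = (\<Sum>l\<in>L1. a1 l y * iter_deriv l g (\<tau> y))"
    by (rule pullback_operatorE) (rule that)
  from assms(3) obtain L2 a2 where 2: "finite L2" "\<And>l. l \<in> L2 \<Longrightarrow> length l \<le> n"
    "\<And>l. l \<in> L2 \<Longrightarrow> smooth_on S (a2 l)"
    "\<And>g y. smooth_on T g \<Longrightarrow> y \<in> S \<Longrightarrow> D2 g y = (\<Sum>l\<in>L2. a2 l y * iter_deriv l g (\<tau> y))"
    by (rule pullback_operatorE) (rule that)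
  \<comment> \<open>Coefficients are set to 0 outside their own index set, so that both sums can run
    over the union.\<close>
  define a where "a = (\<lambda>l y. (if l \<in> L1 then a1 l y else 0) + (if l \<in> L2 then a2 l y else 0))"
  have sm: "smooth_on S (a l)" if "l \<in> L1 \<union> L2" for l
  proof -
    have *: "smooth_on S (\<lambda>y. if Q then c y else 0)" if "Q \<Longrightarrow> smooth_on S c" for Q and c :: "'a \<Rightarrow> complex"
      by (cases Q) (simp_all add: that smooth_on_const S)
    show ?thesis unfolding a_def by (rule smooth_on_add[OF S *[OF 1(3)] *[OF 2(3)]])
  qed
  have "D1 g y + D2 g y = (\<Sum>l\<in>L1 \<union> L2. a l y * iter_deriv l g (\<tau> y))"
    if "smooth_on T g" "y \<in> S" for g y
  proof -
    have "(\<Sum>l\<in>L1 \<union> L2. a l y * iter_deriv l g (\<tau> y)) =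
      (\<Sum>l\<in>L1 \<union> L2. if l \<in> L1 then a1 l y * iter_deriv l g (\<tau> y) else 0) +
      (\<Sum>l\<in>L1 \<union> L2. if l \<in> L2 then a2 l y * iter_deriv l g (\<tau> y) else 0)"
      unfolding sum.distrib[symmetric] by (intro sum.cong refl) (simp add: a_def distrib_right)
    also have "\<dots> = (\<Sum>l\<in>(L1 \<union> L2) \<inter> L1. a1 l y * iter_deriv l g (\<tau> y)) +
       (\<Sum>l\<in>(L1 \<union> L2) \<inter> L2. a2 l y * iter_deriv l g (\<tau> y))"
      using 1(1) 2(1) by (simp only: sum.inter_restrict finite_Un)
    also have "(L1 \<union> L2) \<inter> L1 = L1" by blast
    also have "(L1 \<union> L2) \<inter> L2 = L2" by blast
    finally show ?thesis using 1(4)[OF that] 2(4)[OF that] by simp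
  qed
  then show ?thesis unfolding pullback_operator_def
    using 1 2 sm by (intro exI[of _ "L1 \<union> L2"] exI[of _ a]) auto
qed

lemma pullback_operator_sum:
  "open S \<Longrightarrow> (\<And>i. i \<in> I \<Longrightarrow> pullback_operator S T \<tau> n (D i)) \<Longrightarrow>
    pullback_operator S T \<tau> n (\<lambda>g y. \<Sum>i\<in>I. D i g y)"
  by (induction I rule: infinite_finite_induct)
    (auto intro: pullback_operator_add pullback_operator_zero)

lemma pullback_operator_cong:
  assumes "\<And>g y. smooth_on T g \<Longrightarrow> y \<in> S \<Longrightarrow> D g y = D' g y" "pullback_operator S T \<tau> n D'"
  shows "pullback_operator S T \<tau> n D"
  using assms unfolding pullback_operator_def by simp

text \<open>One more derivative falls either on a coefficient or, through the chain rule, on g,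
  raising the order by at most one. Recording only the smoothness of the coefficients and their
  independence of g avoids the explicit higher chain rule.\<close>

lemma pullback_operator_iter_deriv:
  fixes B :: "'e::real_inner set" and \<tau> :: "'e \<Rightarrow> 'e"
  assumes B: "parseval_frame B" and S: "open S" and \<tau>: "smooth_on S \<tau>" "\<tau> ` S \<subseteq> T"
  shows "pullback_operator S T \<tau> (length l) (\<lambda>g. iter_deriv l (\<lambda>y. g (\<tau> y)))"
proof (induction l)
  case Nil
  show ?case
    unfolding pullback_operator_def
    by (intro exI[of _ "{[]}"] exI[of _ "\<lambda>_ _. 1"]) (simp add: smooth_on_const S)
next
  case (Cons v l)
  from Cons.IH obtain L and a :: "'e list \<Rightarrow> 'e \<Rightarrow> complex"
    where L: "finite L" "\<And>m. m \<in> L \<Longrightarrow> length m \<le> length l"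
    "\<And>m. m \<in> L \<Longrightarrow> smooth_on S (a m)" and D: "\<And>g y. smooth_on T g \<Longrightarrow> y \<in> S \<Longrightarrow>
      iter_deriv l (\<lambda>y. g (\<tau> y)) y = (\<Sum>m\<in>L. a m y * iter_deriv m g (\<tau> y))"
    by (rule pullback_operatorE) (rule that)
  define d where "d = (\<lambda>b y. of_real (frechet_derivative \<tau> (at y) v \<bullet> b) :: complex)"
  have d: "smooth_on S (d b)" for b
  proof -
    have 1: "smooth_on S (\<lambda>y. (frechet_derivative \<tau> (at y) v \<bullet> b) *\<^sub>R (1::complex))"
      by (intro smooth_on_scaleR smooth_on_inner smooth_on_const smooth_on_frechet_derivative S \<tau>(1))
    show ?thesis unfolding d_def by (rule smooth_on_cong[OF S _ 1]) (simp add: scaleR_conv_of_real)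
  qed
  show ?case
  proof (rule pullback_operator_cong)
    show "pullback_operator S T \<tau> (length (v # l)) (\<lambda>g y. \<Sum>m\<in>L.
        frechet_derivative (a m) (at y) v * iter_deriv m g (\<tau> y) +
        (\<Sum>b\<in>B. (a m y * d b y) * iter_deriv (b # m) g (\<tau> y)))"
    proof (rule pullback_operator_sum[OF S])
      fix m assume m: "m \<in> L"
      have "smooth_on S (\<lambda>y. a m y * d b y)" for b
        by (rule smooth_on_mult[OF S L(3)[OF m] d])
      then have "pullback_operator S T \<tau> (length (v # l))
          (\<lambda>g y. \<Sum>b\<in>B. (a m y * d b y) * iter_deriv (b # m) g (\<tau> y))"
        using L(2)[OF m] by (intro pullback_operator_sum[OF S] pullback_operator_single) auto
      moreover have "pullback_operator S T \<tau> (length (v # l))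
          (\<lambda>g y. frechet_derivative (a m) (at y) v * iter_deriv m g (\<tau> y))"
        using L(2)[OF m] smooth_on_frechet_derivative[OF L(3)[OF m]]
        by (intro pullback_operator_single) auto
      ultimately show "pullback_operator S T \<tau> (length (v # l)) (\<lambda>g y.
          frechet_derivative (a m) (at y) v * iter_deriv m g (\<tau> y) +
          (\<Sum>b\<in>B. (a m y * d b y) * iter_deriv (b # m) g (\<tau> y)))"
        by (rule pullback_operator_add[OF S, rotated])
    qed
    fix g :: "'e \<Rightarrow> complex" and y assume g: "smooth_on T g" and y: "y \<in> S"
    have 1: "frechet_derivative (iter_deriv l (\<lambda>y. g (\<tau> y))) (at y) =
        frechet_derivative (\<lambda>y. \<Sum>m\<in>L. a m y * iter_deriv m g (\<tau> y)) (at y)"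
      by (rule frechet_derivative_cong_open[OF S y D[OF g]])
    have 2: "((\<lambda>y. \<Sum>m\<in>L. a m y * iter_deriv m g (\<tau> y)) has_derivative
      (\<lambda>v. \<Sum>m\<in>L. a m y * (\<Sum>b\<in>B. (frechet_derivative \<tau> (at y) v \<bullet> b) *\<^sub>R
            frechet_derivative (iter_deriv m g) (at (\<tau> y)) b) +
          frechet_derivative (a m) (at y) v * iter_deriv m g (\<tau> y))) (at y)"
    proof (intro has_derivative_sum has_derivative_mult)
      fix m assume m: "m \<in> L"
      show "(a m has_derivative frechet_derivative (a m) (at y)) (at y)"
        using smooth_on_differentiable[OF L(3)[OF m] y] frechet_derivative_works by blast
      show "((\<lambda>y. iter_deriv m g (\<tau> y)) has_derivative (\<lambda>v. \<Sum>b\<in>B. (frechet_derivative \<tau> (at y) v \<bullet> b) *\<^sub>R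
            frechet_derivative (iter_deriv m g) (at (\<tau> y)) b)) (at y)"
        by (rule has_derivative_compose_frame[OF B smooth_on_differentiable[OF \<tau>(1) y]
              smooth_on_differentiable[OF smooth_on_iter_deriv[OF g]]]) (use y \<tau>(2) in auto)
    qed
    have "iter_deriv (v # l) (\<lambda>y. g (\<tau> y)) y = (\<Sum>m\<in>L. a m y * (\<Sum>b\<in>B. (frechet_derivative \<tau> (at y) v \<bullet> b) *\<^sub>R
            frechet_derivative (iter_deriv m g) (at (\<tau> y)) b) +
          frechet_derivative (a m) (at y) v * iter_deriv m g (\<tau> y))"
      unfolding iter_deriv.simps 1 frechet_derivative_at[OF 2, symmetric] by (rule refl)
    also have "\<dots> = (\<Sum>m\<in>L.
        frechet_derivative (a m) (at y) v * iter_deriv m g (\<tau> y) +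
        (\<Sum>b\<in>B. (a m y * d b y) * iter_deriv (b # m) g (\<tau> y)))"
    proof (rule sum.cong[OF refl])
      fix m
      have "a m y * (\<Sum>b\<in>B. (frechet_derivative \<tau> (at y) v \<bullet> b) *\<^sub>R
            frechet_derivative (iter_deriv m g) (at (\<tau> y)) b) =
        (\<Sum>b\<in>B. (a m y * d b y) * iter_deriv (b # m) g (\<tau> y))"
        by (simp add: d_def scaleR_conv_of_real sum_distrib_left mult.assoc)
      then show "a m y * (\<Sum>b\<in>B. (frechet_derivative \<tau> (at y) v \<bullet> b) *\<^sub>R
            frechet_derivative (iter_deriv m g) (at (\<tau> y)) b) +
          frechet_derivative (a m) (at y) v * iter_deriv m g (\<tau> y) =
        frechet_derivative (a m) (at y) v * iter_deriv m g (\<tau> y) +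
        (\<Sum>b\<in>B. (a m y * d b y) * iter_deriv (b # m) g (\<tau> y))"
        by (simp only: add.commute)
    qed
    finally show "iter_deriv (v # l) (\<lambda>y. g (\<tau> y)) y = (\<Sum>m\<in>L.
        frechet_derivative (a m) (at y) v * iter_deriv m g (\<tau> y) +
        (\<Sum>b\<in>B. (a m y * d b y) * iter_deriv (b # m) g (\<tau> y)))" .
  qed
qed

lemma isCont_closure_zero:
  fixes f :: "'a::metric_space \<Rightarrow> 'b::real_normed_vector"
  assumes "isCont f p" "p \<in> closure A" "\<And>y. y \<in> A \<Longrightarrow> f y = 0"
  shows "f p = 0"
proof -
  obtain s where s: "\<And>n. s n \<in> A" "s \<longlonglongrightarrow> p" using assms(2) closure_sequential by blast
  have "(\<lambda>n. f (s n)) \<longlonglongrightarrow> f p" by (rule isCont_tendsto_compose[OF assms(1) s(2)])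
  then show ?thesis using s(1) assms(3) by (simp add: LIMSEQ_const_iff)
qed

section \<open>Charts, extension by zero and flatness in charts\<close>

locale manifold_with_frame =
  fixes atlas :: "('m::{t2_space,second_countable_topology}, 'e::{real_inner,heine_borel}) chart set"
    and B :: "'e set"
  assumes manifold: "smooth_manifold atlas" and frame: "parseval_frame B"
begin

lemma chart_covers: "\<exists>U \<phi>. (U, \<phi>) \<in> atlas \<and> x \<in> U"
proof -
  have "x \<in> (\<Union>(U, \<phi>)\<in>atlas. U)" using manifold by (simp add: smooth_manifold_def)
  then show ?thesis by auto
qed

context
  fixes U \<phi> assumes c: "(U, \<phi>) \<in> atlas"
begin

lemma chart_homeomorphism: "homeomorphism U (\<phi> ` U) \<phi> (inv_into U \<phi>)"
  and chart_open: "open U" and chart_image_open: "open (\<phi> ` U)"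
  using manifold c unfolding smooth_manifold_def by fast+

lemma chart_inv: "x \<in> U \<Longrightarrow> inv_into U \<phi> (\<phi> x) = x"
  using chart_homeomorphism by (simp add: homeomorphism_def)

lemma chart_inv_mem: "y \<in> \<phi> ` U \<Longrightarrow> inv_into U \<phi> y \<in> U"
  and chart_inv_right: "y \<in> \<phi> ` U \<Longrightarrow> \<phi> (inv_into U \<phi> y) = y"
  by (auto simp: inv_into_into f_inv_into_f)

lemma open_chart_image: "open W \<Longrightarrow> open (\<phi> ` (U \<inter> W))"
  using homeomorphism_imp_open_map[OF chart_homeomorphism, of "U \<inter> W"] chart_image_open
    openin_open_Int openin_open_trans by blast

lemma open_chart_inv_image: "open W \<Longrightarrow> W \<subseteq> \<phi> ` U \<Longrightarrow> open (inv_into U \<phi> ` W)"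
  using homeomorphism_imp_open_map[OF homeomorphism_symD[OF chart_homeomorphism], of W] chart_open
    openin_open_trans open_openin_trans openin_open_eq[of "\<phi> ` U" W] chart_image_open by blast

end

lemma transition_smooth:
  assumes "(U, \<phi>) \<in> atlas" "(V, \<psi>) \<in> atlas"
  shows "smooth_on (\<phi> ` (U \<inter> V)) (\<lambda>y. \<psi> (inv_into U \<phi> y))"
  using manifold assms unfolding smooth_manifold_def o_def by fast

lemma smooth_functionsD:
  "f \<in> smooth_functions atlas \<Longrightarrow> (U, \<phi>) \<in> atlas \<Longrightarrow> smooth_on (\<phi> ` U) (\<lambda>y. f (inv_into U \<phi> y))"
  unfolding smooth_functions_def o_def by fast

lemma smooth_functionsI:
  "(\<And>U \<phi>. (U, \<phi>) \<in> atlas \<Longrightarrow> smooth_on (\<phi> ` U) (\<lambda>y. f (inv_into U \<phi> y))) \<Longrightarrow> f \<in> smooth_functions atlas"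
  unfolding smooth_functions_def o_def by fast

definition chart_extend :: "'m set \<Rightarrow> ('m \<Rightarrow> 'e) \<Rightarrow> ('e \<Rightarrow> complex) \<Rightarrow> 'm \<Rightarrow> complex" where
  "chart_extend U \<phi> w x = (if x \<in> U then w (\<phi> x) else 0)"

text \<open>The closed ball corresponds to a compact set K in U, which is closed because the
  manifold is Hausdorff. So U and the complement of K form an open cover, and smoothness is clear on
  each. Smoothness of w is asked only on the overlap of the charts, since coefficients produced by a
  change of chart exist only there.\<close>

lemma smooth_on_chart_extend:
  assumes c: "(U, \<phi>) \<in> atlas" "(V, \<psi>) \<in> atlas" and r: "cball p r \<subseteq> \<phi> ` U"
    and w: "smooth_on (\<phi> ` (U \<inter> V)) w" "\<And>y. y \<notin> cball p r \<Longrightarrow> w y = 0"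
  shows "smooth_on (\<psi> ` V) (\<lambda>y. chart_extend U \<phi> w (inv_into V \<psi> y))"
proof (rule smooth_on_local)
  fix y assume y: "y \<in> \<psi> ` V"
  define K where "K = inv_into U \<phi> ` cball p r"
  have "continuous_on (cball p r) (inv_into U \<phi>)"
    using chart_homeomorphism[OF c(1)] by (intro continuous_on_subset[OF _ r]) (simp add: homeomorphism_def)
  then have "compact K" unfolding K_def by (intro compact_continuous_image) auto
  then have "open (- K)" by (simp add: compact_imp_closed open_Compl)
  show "\<exists>T g. open T \<and> y \<in> T \<and> smooth_on T g \<and> (\<forall>z\<in>T. chart_extend U \<phi> w (inv_into V \<psi> z) = g z)"
  proof (cases "inv_into V \<psi> y \<in> U")
    case True
    let ?T = "\<psi> ` (V \<inter> U)"
    have op: "open ?T" "open (\<phi> ` (U \<inter> V))"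
      using open_chart_image c chart_open by blast+
    have mem: "inv_into V \<psi> z \<in> V \<inter> U" if "z \<in> ?T" for z
      using that chart_inv[OF c(2)] by auto
    have "smooth_on ?T (\<lambda>z. w (\<phi> (inv_into V \<psi> z)))"
      by (rule smooth_on_compose[OF frame op w(1) transition_smooth[OF c(2,1)]]) (use mem in auto)
    moreover have "y \<in> ?T" using True chart_inv_mem[OF c(2) y] chart_inv_right[OF c(2) y] by (metis IntI imageI)
    ultimately show ?thesis using op mem
      by (intro exI[of _ ?T] exI[of _ "\<lambda>z. w (\<phi> (inv_into V \<psi> z))"]) (auto simp: chart_extend_def)
  next
    case False
    let ?T = "\<psi> ` (V \<inter> - K)"
    have "open ?T" using open_chart_image[OF c(2) \<open>open (- K)\<close>] .
    moreover have "K \<subseteq> U" unfolding K_def using r chart_inv_mem[OF c(1)] by auto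
    then have "y \<in> ?T"
      using False chart_inv_mem[OF c(2) y] chart_inv_right[OF c(2) y] by (metis ComplI IntI imageI subsetD)
    moreover have "chart_extend U \<phi> w (inv_into V \<psi> z) = 0" if "z \<in> ?T" for z
    proof -
      have nK: "inv_into V \<psi> z \<notin> K" using that chart_inv[OF c(2)] by auto
      show ?thesis
      proof (cases "inv_into V \<psi> z \<in> U")
        case True
        have "\<phi> (inv_into V \<psi> z) \<notin> cball p r"
          using nK chart_inv[OF c(1) True] unfolding K_def by (metis imageI)
        then show ?thesis by (simp add: chart_extend_def w(2))
      qed (simp add: chart_extend_def)
    qed
    ultimately show ?thesis
      by (intro exI[of _ ?T] exI[of _ "\<lambda>_. 0"]) (simp add: smooth_on_const)
  qed
qed

lemma chart_extend_smooth:
  assumes c: "(U, \<phi>) \<in> atlas" and r: "cball p r \<subseteq> \<phi> ` U"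
    and w: "smooth_on (\<phi> ` U) w" "\<And>y. y \<notin> cball p r \<Longrightarrow> w y = 0"
  shows "chart_extend U \<phi> w \<in> smooth_functions atlas"
  using smooth_on_chart_extend[OF c _ r smooth_on_subset[OF w(1)] w(2)]
  by (intro smooth_functionsI) blast

lemma of_real_smooth_on:
  "open S \<Longrightarrow> smooth_on S \<sigma> \<Longrightarrow> smooth_on S (\<lambda>y. complex_of_real (\<sigma> y))"
  using smooth_on_scaleR[of S \<sigma> "\<lambda>_. 1::complex"] smooth_on_const[of S "1::complex"] by (simp add: scaleR_conv_of_real)

text \<open>Supplies the test operators for flatness: a chart derivative alone is not defined
  globally, but its product with a bump is. The content lies in the other charts, where the
  coefficients are those of the pulled back derivative times the bump.\<close>

lemma localized_derivative_differential_operator: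
  assumes c: "(U, \<phi>) \<in> atlas" and r: "cball p r \<subseteq> \<phi> ` U"
    and \<sigma>: "smooth_on UNIV \<sigma>" "\<And>y. y \<notin> cball p r \<Longrightarrow> \<sigma> y = 0"
  shows "differential_operator atlas
    (\<lambda>f. chart_extend U \<phi> (\<lambda>y. complex_of_real (\<sigma> y) * iter_deriv l (\<lambda>y. f (inv_into U \<phi> y)) y))"
    (is "differential_operator atlas ?D")
  unfolding differential_operator_def
proof (intro conjI exI[of _ "length l"])
  have \<sigma>U: "smooth_on (\<phi> ` (U \<inter> V)) (\<lambda>y. complex_of_real (\<sigma> y))" if "open V" for V
    using open_chart_image[OF c that] \<sigma>(1) smooth_on_subset by (intro of_real_smooth_on) blast+
  show "?D \<in> smooth_functions atlas \<rightarrow> smooth_functions atlas"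
  proof
    fix f assume "f \<in> smooth_functions atlas"
    then show "?D f \<in> smooth_functions atlas"
      using \<sigma>U[OF open_UNIV] smooth_functionsD c
      by (intro chart_extend_smooth[OF c r] smooth_on_mult smooth_on_iter_deriv chart_image_open)
        (auto simp: \<sigma>(2))
  qed
  show "\<forall>(V, \<psi>)\<in>atlas. \<exists>L a. finite L \<and> (\<forall>m\<in>L. length m \<le> length l \<and> smooth_on (\<psi> ` V) (a m)) \<and>
     (\<forall>f\<in>smooth_functions atlas. \<forall>x\<in>V. ?D f x = (\<Sum>m\<in>L. a m (\<psi> x) * iter_deriv m (f \<circ> inv_into V \<psi>) (\<psi> x)))"
  proof clarify
    fix V \<psi> assume d: "(V, \<psi>) \<in> atlas"
    let ?S = "\<phi> ` (U \<inter> V)"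
    have S: "open ?S" using open_chart_image c d chart_open by blast
    have "pullback_operator ?S (\<psi> ` V) (\<lambda>y. \<psi> (inv_into U \<phi> y)) (length l)
        (\<lambda>g. iter_deriv l (\<lambda>y. g (\<psi> (inv_into U \<phi> y))))"
      using chart_inv[OF c] by (intro pullback_operator_iter_deriv[OF frame S transition_smooth[OF c d]]) auto
    then obtain L and a :: "'e list \<Rightarrow> 'e \<Rightarrow> complex" where L: "finite L" "\<And>m. m \<in> L \<Longrightarrow> length m \<le> length l" "\<And>m. m \<in> L \<Longrightarrow> smooth_on ?S (a m)"
      and D: "\<And>g y. smooth_on (\<psi> ` V) g \<Longrightarrow> y \<in> ?S \<Longrightarrow>
        iter_deriv l (\<lambda>y. g (\<psi> (inv_into U \<phi> y))) y = (\<Sum>m\<in>L. a m y * iter_deriv m g (\<psi> (inv_into U \<phi> y)))"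
      by (rule pullback_operatorE) (rule that)
    \<comment> \<open>The cut-off coefficients are carried over to V and vanish off the overlap,
      where both sides of the operator identity are 0.\<close>
    define a' where "a' = (\<lambda>m y. chart_extend U \<phi> (\<lambda>y. complex_of_real (\<sigma> y) * a m y) (inv_into V \<psi> y))"
    have "smooth_on (\<psi> ` V) (a' m)" if "m \<in> L" for m
      unfolding a'_def using that L(3) \<sigma>U chart_open[OF d] S \<sigma>(2)
      by (intro smooth_on_chart_extend[OF c d r] smooth_on_mult) auto
    moreover have "?D f x = (\<Sum>m\<in>L. a' m (\<psi> x) * iter_deriv m (f \<circ> inv_into V \<psi>) (\<psi> x))"
      if f: "f \<in> smooth_functions atlas" and x: "x \<in> V" for f x
    proof (cases "x \<in> U")
      case True
      let ?g = "\<lambda>y. f (inv_into V \<psi> y)"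
      have "f (inv_into U \<phi> y) = ?g (\<psi> (inv_into U \<phi> y))" if "y \<in> ?S" for y
        using that chart_inv[OF c] chart_inv[OF d] by auto
      then have "iter_deriv l (\<lambda>y. f (inv_into U \<phi> y)) (\<phi> x) =
          iter_deriv l (\<lambda>y. ?g (\<psi> (inv_into U \<phi> y))) (\<phi> x)"
        using True x by (intro iter_deriv_cong_open[OF S]) auto
      also have "\<dots> = (\<Sum>m\<in>L. a m (\<phi> x) * iter_deriv m ?g (\<psi> x))"
        using D[OF smooth_functionsD[OF f d], of "\<phi> x"] True x by (simp add: chart_inv[OF c])
      finally show ?thesis using True x
        by (simp add: chart_extend_def a'_def chart_inv[OF d] o_def sum_distrib_left mult.assoc)
    next
      case False
      then show ?thesis by (simp add: chart_extend_def a'_def chart_inv[OF d x])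
    qed
    ultimately show "\<exists>L a. finite L \<and> (\<forall>m\<in>L. length m \<le> length l \<and> smooth_on (\<psi> ` V) (a m)) \<and>
     (\<forall>f\<in>smooth_functions atlas. \<forall>x\<in>V. ?D f x = (\<Sum>m\<in>L. a m (\<psi> x) * iter_deriv m (f \<circ> inv_into V \<psi>) (\<psi> x)))"
      using L(1,2) by (intro exI[of _ L] exI[of _ a']) simp
  qed
qed

text \<open>Forward, derivatives cut off by a bump equal to 1 near the point are admissible test
  operators. Backward, any one chart around x writes \<open>D f x\<close> as a combination of chart
  derivatives at x.\<close>

lemma flat_ideal_iff:
  "f \<in> flat_ideal atlas X \<longleftrightarrow> f \<in> smooth_functions atlas \<and>
    (\<forall>U \<phi> x. (U, \<phi>) \<in> atlas \<longrightarrow> x \<in> U \<inter> X \<longrightarrow> flat_at (\<phi> x) (\<lambda>y. f (inv_into U \<phi> y)))"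
proof (intro iffI conjI allI impI)
  assume f: "f \<in> flat_ideal atlas X"
  then show "f \<in> smooth_functions atlas" by (simp add: flat_ideal_def)
  fix U \<phi> x assume c: "(U, \<phi>) \<in> atlas" and x: "x \<in> U \<inter> X"
  have "\<phi> x \<in> \<phi> ` U" using x by blast
  then obtain \<sigma> :: "'e \<Rightarrow> real" and r \<delta> where \<sigma>: "smooth_on UNIV \<sigma>" "\<delta> > 0" "cball (\<phi> x) r \<subseteq> \<phi> ` U"
    "\<And>y. y \<notin> cball (\<phi> x) r \<Longrightarrow> \<sigma> y = 0" "\<And>y. y \<in> ball (\<phi> x) \<delta> \<Longrightarrow> \<sigma> y = 1"
    by (rule bump_exists[OF chart_image_open[OF c]]) (rule that)
  show "flat_at (\<phi> x) (\<lambda>y. f (inv_into U \<phi> y))"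
    unfolding flat_at_def
  proof
    fix l
    have "chart_extend U \<phi> (\<lambda>y. complex_of_real (\<sigma> y) * iter_deriv l (\<lambda>y. f (inv_into U \<phi> y)) y) x = 0"
      using localized_derivative_differential_operator[OF c \<sigma>(3,1,4), of l] f x
      unfolding flat_ideal_def by blast
    then show "iter_deriv l (\<lambda>y. f (inv_into U \<phi> y)) (\<phi> x) = 0"
      using x \<sigma>(2,5) by (simp add: chart_extend_def)
  qed
next
  assume f: "f \<in> smooth_functions atlas \<and>
    (\<forall>U \<phi> x. (U, \<phi>) \<in> atlas \<longrightarrow> x \<in> U \<inter> X \<longrightarrow> flat_at (\<phi> x) (\<lambda>y. f (inv_into U \<phi> y)))"
  have "D f x = 0" if D: "differential_operator atlas D" and x: "x \<in> X" for D x
  proof -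
    obtain U \<phi> where c: "(U, \<phi>) \<in> atlas" "x \<in> U" using chart_covers by blast
    obtain L and a :: "'e list \<Rightarrow> 'e \<Rightarrow> complex" where
      "D f x = (\<Sum>l\<in>L. a l (\<phi> x) * iter_deriv l (f \<circ> inv_into U \<phi>) (\<phi> x))"
      using D c f unfolding differential_operator_def by fast
    then show ?thesis using f c x unfolding flat_at_def o_def by simp
  qed
  then show "f \<in> flat_ideal atlas X" using f unfolding flat_ideal_def by blast
qed

section \<open>Algebraic closure of smooth and flat functions\<close>

lemma smooth_functions_const: "(\<lambda>_. c) \<in> smooth_functions atlas"
  by (intro smooth_functionsI smooth_on_const chart_image_open)

lemma smooth_functions_add:
  assumes "f \<in> smooth_functions atlas" "g \<in> smooth_functions atlas"
  shows "(\<lambda>x. f x + g x) \<in> smooth_functions atlas"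
  using assms smooth_functionsD by (intro smooth_functionsI smooth_on_add chart_image_open)

lemma smooth_functions_mult:
  assumes "f \<in> smooth_functions atlas" "g \<in> smooth_functions atlas"
  shows "(\<lambda>x. f x * g x) \<in> smooth_functions atlas"
  using assms smooth_functionsD by (intro smooth_functionsI smooth_on_mult chart_image_open)

lemma flat_ideal_smooth: "f \<in> flat_ideal atlas X \<Longrightarrow> f \<in> smooth_functions atlas"
  by (simp add: flat_ideal_def)

lemma flat_ideal_zero: "(\<lambda>_. 0) \<in> flat_ideal atlas X"
  by (simp add: flat_ideal_iff smooth_functions_const flat_at_zero)

lemma flat_ideal_add:
  assumes "f \<in> flat_ideal atlas X" "g \<in> flat_ideal atlas X"
  shows "(\<lambda>x. f x + g x) \<in> flat_ideal atlas X"
  unfolding flat_ideal_iff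
proof (intro conjI allI impI)
  show "(\<lambda>x. f x + g x) \<in> smooth_functions atlas"
    using assms flat_ideal_smooth by (intro smooth_functions_add)
  fix U \<phi> x assume c: "(U, \<phi>) \<in> atlas" and x: "x \<in> U \<inter> X"
  show "flat_at (\<phi> x) (\<lambda>y. f (inv_into U \<phi> y) + g (inv_into U \<phi> y))"
    using assms c x unfolding flat_ideal_iff
    by (intro flat_at_add[OF chart_image_open[OF c]] smooth_functionsD[OF _ c]) auto
qed

lemma flat_ideal_mult:
  assumes "f \<in> flat_ideal atlas X" "g \<in> smooth_functions atlas"
  shows "(\<lambda>x. f x * g x) \<in> flat_ideal atlas X"
  unfolding flat_ideal_iff
proof (intro conjI allI impI)
  show "(\<lambda>x. f x * g x) \<in> smooth_functions atlas"
    using assms flat_ideal_smooth by (intro smooth_functions_mult)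
  fix U \<phi> x assume c: "(U, \<phi>) \<in> atlas" and x: "x \<in> U \<inter> X"
  show "flat_at (\<phi> x) (\<lambda>y. f (inv_into U \<phi> y) * g (inv_into U \<phi> y))"
    using assms c x unfolding flat_ideal_iff
    by (intro flat_at_mult_left[OF chart_image_open[OF c]] smooth_functionsD[OF _ c]) auto
qed

text \<open>The hypotheses are what a cochain with one argument fixed satisfies. Locality speaks of
  open sets of the manifold, whereas the splitting happens in a chart; the work lies in passing
  between the two by cut-off and extension by zero.\<close>

lemma local_operator_preserves_flat_ideal:
  assumes smooth: "\<And>u. u \<in> smooth_functions atlas \<Longrightarrow> op u \<in> smooth_functions atlas"
    and add: "\<And>u v x. u \<in> smooth_functions atlas \<Longrightarrow> v \<in> smooth_functions atlas \<Longrightarrow>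
      op (\<lambda>x. u x + v x) x = op u x + op v x"
    and local: "\<And>u x. u \<in> smooth_functions atlas \<Longrightarrow> x \<notin> supp u \<Longrightarrow> op u x = 0"
    and f: "f \<in> flat_ideal atlas X"
  shows "op f \<in> flat_ideal atlas X"
  unfolding flat_ideal_iff
proof (intro conjI allI impI)
  have fs: "f \<in> smooth_functions atlas" using f by (rule flat_ideal_smooth)
  then show "op f \<in> smooth_functions atlas" by (rule smooth)
  fix U \<phi> x assume c: "(U, \<phi>) \<in> atlas" and x: "x \<in> U \<inter> X"
  let ?p = "\<phi> x" and ?i = "inv_into U \<phi>"
  have op: "open (\<phi> ` U)" by (rule chart_image_open[OF c])
  have p: "?p \<in> \<phi> ` U" using x by blast
  then obtain \<sigma> :: "'e \<Rightarrow> real" and r \<delta> where \<sigma>: "smooth_on UNIV \<sigma>" "\<delta> > 0" "cball ?p r \<subseteq> \<phi> ` U"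
    "\<And>y. y \<notin> cball ?p r \<Longrightarrow> \<sigma> y = 0" "\<And>y. y \<in> ball ?p \<delta> \<Longrightarrow> \<sigma> y = 1"
    by (rule bump_exists[OF op]) (rule that)
  \<comment> \<open>The cut-off forces the splitting to vanish outside a closed ball inside the
    chart, and near p, where \<sigma> is 1, it leaves f unchanged.\<close>
  let ?f = "\<lambda>y. \<sigma> y *\<^sub>R f (?i y)"
  have fi: "smooth_on (\<phi> ` U) (\<lambda>y. f (?i y))" by (rule smooth_functionsD[OF fs c])
  have \<sigma>U: "smooth_on (\<phi> ` U) \<sigma>" using \<sigma>(1) by (rule smooth_on_subset) simp
  have "flat_at ?p ?f"
    using f c x unfolding flat_ideal_iff by (intro flat_at_scaleR[OF op p \<sigma>U fi]) blast
  with smooth_on_scaleR[OF op \<sigma>U fi] obtain g V W where g: "smooth_on (\<phi> ` U) g" "\<And>y. ?f y = 0 \<Longrightarrow> g y = 0"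
    and VW: "open V" "open W" "?p \<in> closure V" "?p \<in> closure W"
    "\<And>y. y \<in> V \<Longrightarrow> g y = ?f y" "\<And>y. y \<in> W \<Longrightarrow> g y = 0"
    by (rule flat_at_splitting[OF frame op p]) (rule that)
  let ?g = "chart_extend U \<phi> g"
  have gs: "?g \<in> smooth_functions atlas"
    by (rule chart_extend_smooth[OF c \<sigma>(3) g(1)]) (simp add: g(2) \<sigma>(4))
  define N where "N = ball ?p \<delta> \<inter> \<phi> ` U"
  have N: "open N" "?p \<in> N" using op p \<sigma>(2) by (auto simp: N_def)
  have cl: "?p \<in> closure (N \<inter> V)" "?p \<in> closure (N \<inter> W)"
    using open_Int_closure_subset[OF N(1)] N(2) VW(3,4) by blast+
  \<comment> \<open>An open set on which u vanishes is disjoint from the closure that defines the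
    support, so locality applies at each of its points.\<close>
  have zero: "op u (?i y) = 0"
    if u: "u \<in> smooth_functions atlas" and A: "open A" "A \<subseteq> \<phi> ` U" "y \<in> A"
      "\<And>z. z \<in> A \<Longrightarrow> u (?i z) = 0" for u A y
  proof (rule local[OF u])
    have "?i ` A \<inter> supp u = {}"
      unfolding supp_def using A(4) open_Int_closure_eq_empty[OF open_chart_inv_image[OF c A(1,2)]] by auto
    then show "?i y \<notin> supp u" using A(3) by blast
  qed
  \<comment> \<open>Additivity is applied to f = g + h, where h vanishes over the intersection of N
    and V.\<close>
  let ?h = "\<lambda>x. f x + (- 1) * ?g x"
  have hs: "?h \<in> smooth_functions atlas"
    by (intro smooth_functions_add smooth_functions_mult smooth_functions_const fs gs)
  have gi: "?g (?i y) = g y" if "y \<in> \<phi> ` U" for y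
    using chart_inv_mem[OF c that] chart_inv_right[OF c that] by (simp add: chart_extend_def)
  have onV: "op f (?i y) = op ?g (?i y)" if y: "y \<in> N \<inter> V" for y
  proof -
    have "op ?h (?i y) = 0"
      using y N VW(1) by (intro zero[OF hs, of "N \<inter> V"]) (auto simp: N_def gi VW(5) \<sigma>(5))
    then show ?thesis using add[OF gs hs, of "?i y"] by simp
  qed
  have onW: "op ?g (?i y) = 0" if y: "y \<in> N \<inter> W" for y
    using y N VW(2) by (intro zero[OF gs, of "N \<inter> W"]) (auto simp: N_def gi VW(6))
  show "flat_at ?p (\<lambda>y. op f (?i y))"
    unfolding flat_at_def
  proof
    fix l
    let ?F = "iter_deriv l (\<lambda>y. op f (?i y))" and ?G = "iter_deriv l (\<lambda>y. op ?g (?i y))"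
    have "smooth_on (\<phi> ` U) (\<lambda>y. op f (?i y))" "smooth_on (\<phi> ` U) (\<lambda>y. op ?g (?i y))"
      using smooth_functionsD[OF smooth c] fs gs by blast+
    then have cont: "isCont ?F ?p" "isCont ?G ?p"
      using p unfolding smooth_on_def by (blast intro: differentiable_imp_continuous_within)+
    have FG: "?F y - ?G y = 0" if "y \<in> N \<inter> V" for y
      using iter_deriv_cong_open[of "N \<inter> V" y "\<lambda>y. op f (?i y)" "\<lambda>y. op ?g (?i y)" l] that onV N VW(1)
      by auto
    have "?F ?p - ?G ?p = 0"
      by (rule isCont_closure_zero[OF continuous_diff[OF cont] cl(1) FG])
    moreover have G: "?G y = 0" if "y \<in> N \<inter> W" for y
    proof -
      have "?G y = iter_deriv l (\<lambda>_. 0) y"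
        using onW by (rule iter_deriv_cong_open[OF open_Int[OF N(1) VW(2)] that])
      also have "\<dots> = 0" using flat_at_zero[of y] unfolding flat_at_def by metis
      finally show ?thesis .
    qed
    have "?G ?p = 0"
      by (rule isCont_closure_zero[OF cont(2) cl(2) G])
    ultimately show "?F ?p = 0" by simp
  qed
qed

end

section \<open>Star products and stable ideals\<close>

lemma hseriesD: "a \<in> hseries S \<Longrightarrow> a k \<in> S"
  by (simp add: hseries_def)

lemma hseriesI: "(\<And>k. a k \<in> S) \<Longrightarrow> a \<in> hseries S"
  by (simp add: hseries_def)

lemma deformed_simps [simp]:
  "carrier (deformed A st) = hseries (carrier A)" "mult (deformed A st) = st"
  "one (deformed A st) = hmonom A 0 \<one>\<^bsub>A\<^esub>" "zero (deformed A st) = (\<lambda>k. \<zero>\<^bsub>A\<^esub>)"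
  "add (deformed A st) a b = (\<lambda>k. a k \<oplus>\<^bsub>A\<^esub> b k)"
  "smult (deformed A st) r a =
    (\<lambda>k. \<Oplus>\<^bsub>A\<^esub>i\<in>{..k}. complex_of_real (fps_nth r i) \<odot>\<^bsub>A\<^esub> a (k - i))"
  by (simp_all add: deformed_def)

lemma hmonom_zero [simp]: "hmonom A n F n = F"
  by (simp add: hmonom_def)

lemma deformed_abelian_group:
  fixes A :: "(complex, 'a) module" (structure)
  assumes "abelian_group A"
  shows "abelian_group (deformed A st)"
proof -
  interpret abelian_group A by fact
  show ?thesis
  proof (rule abelian_groupI)
    fix a assume "a \<in> carrier (deformed A st)"
    then show "\<exists>b\<in>carrier (deformed A st). b \<oplus>\<^bsub>deformed A st\<^esub> a = \<zero>\<^bsub>deformed A st\<^esub>"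
      by (intro bexI[of _ "\<lambda>k. \<ominus> a k"]) (auto simp: hseries_def l_neg)
  qed (auto simp: hseries_def a_ac fun_eq_iff)
qed

lemma deformed_uminus:
  fixes A :: "(complex, 'a) module" (structure)
  assumes "abelian_group A" "b \<in> hseries (carrier A)"
  shows "\<ominus>\<^bsub>deformed A st\<^esub> b = (\<lambda>k. \<ominus> b k)"
proof -
  interpret abelian_group A by fact
  interpret D: abelian_group "deformed A st" by (rule deformed_abelian_group[OF assms(1)])
  show ?thesis
    using assms(2) by (intro D.minus_equality) (auto simp: hseries_def l_neg)
qed

locale complex_comm_algebra = cring A for A :: "(complex, 'a) module" (structure) +
  assumes smult_closed: "F \<in> carrier A \<Longrightarrow> r \<odot> F \<in> carrier A"
    and smult_mult: "\<lbrakk>F \<in> carrier A; G \<in> carrier A\<rbrakk> \<Longrightarrow> (r \<odot> F) \<otimes> G = r \<odot> (F \<otimes> G)"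
    and smult_smult: "F \<in> carrier A \<Longrightarrow> r \<odot> (s \<odot> F) = (r * s) \<odot> F"
    and smult_one: "F \<in> carrier A \<Longrightarrow> 1 \<odot> F = F"
    and smult_zero: "F \<in> carrier A \<Longrightarrow> 0 \<odot> F = \<zero>"
begin

text \<open>Scalars act as ring elements, so distributivity and the stability of ring ideals under
  scalars follow from the ring axioms.\<close>

lemma smult_conv_mult: "F \<in> carrier A \<Longrightarrow> r \<odot> F = (r \<odot> \<one>) \<otimes> F"
  by (simp add: smult_mult)

lemma smult_add: "\<lbrakk>F \<in> carrier A; G \<in> carrier A\<rbrakk> \<Longrightarrow> r \<odot> (F \<oplus> G) = r \<odot> F \<oplus> r \<odot> G"
  by (simp add: smult_conv_mult[of "_ \<oplus> _"] smult_conv_mult[of F] smult_conv_mult[of G]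
      smult_closed r_distr)

lemma smult_ideal: "ideal J A \<Longrightarrow> F \<in> J \<Longrightarrow> r \<odot> F \<in> J"
  using ideal.I_l_closed ideal.Icarr smult_conv_mult smult_closed by (metis one_closed)

text \<open>\<open>fps_X\<close> is the formal variable \<hbar>: only the index 1 survives in the
  convolution, which makes the action a shift of coefficients.\<close>

lemma deformed_smult_X:
  assumes "a \<in> hseries (carrier A)"
  shows "fps_X \<odot>\<^bsub>deformed A st\<^esub> a = (\<lambda>k. case k of 0 \<Rightarrow> \<zero> | Suc m \<Rightarrow> a m)"
proof
  fix k
  have *: "complex_of_real (fps_nth fps_X i) \<odot> a (k - i) = (if 1 = i then a (k - i) else \<zero>)" for i
    using hseriesD[OF assms] by (simp add: smult_one smult_zero fps_X_def)
  show "(fps_X \<odot>\<^bsub>deformed A st\<^esub> a) k = (case k of 0 \<Rightarrow> \<zero> | Suc m \<Rightarrow> a m)"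
  proof (cases k)
    case 0 then show ?thesis using hseriesD[OF assms] by (simp add: smult_zero)
  next
    case (Suc m)
    then show ?thesis
      using add.finprod_singleton[of 1 "{..k}" "\<lambda>i. a (k - i)"] hseriesD[OF assms]
      unfolding deformed_simps * by (simp add: finsum_def)
  qed
qed

end

text \<open>The interface between geometry and algebra: J is an ideal for the commutative product,
  and the two assumptions say that every cochain maps into J as soon as one argument lies in
  J.\<close>

locale star_ideal = complex_comm_algebra A + star_product A br st + ideal J A
  for A :: "(complex, 'a) module" (structure) and br st J +
  assumes cochain_left: "\<lbrakk>F \<in> J; G \<in> carrier A\<rbrakk> \<Longrightarrow> st (hmonom A 0 F) (hmonom A 0 G) k \<in> J"
    and cochain_right: "\<lbrakk>F \<in> J; G \<in> carrier A\<rbrakk> \<Longrightarrow> st (hmonom A 0 G) (hmonom A 0 F) k \<in> J"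
begin

abbreviation "S \<equiv> hseries (carrier A)"
abbreviation "hm \<equiv> hmonom A 0"

lemma hm_closed: "F \<in> carrier A \<Longrightarrow> hm F \<in> S"
  by (simp add: hseries_def hmonom_def)

lemma st_closed: "a \<in> S \<Longrightarrow> b \<in> S \<Longrightarrow> st a b \<in> S"
  using star_linear unfolding bilinear_over_def by simp

lemma add_series_closed: "a \<in> S \<Longrightarrow> b \<in> S \<Longrightarrow> (\<lambda>k. a k \<oplus> b k) \<in> S"
  by (simp add: hseries_def)

lemma st_add_left: "\<lbrakk>a \<in> S; a' \<in> S; b \<in> S\<rbrakk> \<Longrightarrow> st (\<lambda>k. a k \<oplus> a' k) b = (\<lambda>k. st a b k \<oplus> st a' b k)"
  and st_add_right: "\<lbrakk>a \<in> S; a' \<in> S; b \<in> S\<rbrakk> \<Longrightarrow> st b (\<lambda>k. a k \<oplus> a' k) = (\<lambda>k. st b a k \<oplus> st b a' k)"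
  using star_linear unfolding bilinear_over_def by simp_all

lemma st_smult_left: "\<lbrakk>a \<in> S; b \<in> S\<rbrakk> \<Longrightarrow> st (r \<odot>\<^bsub>deformed A st\<^esub> a) b = r \<odot>\<^bsub>deformed A st\<^esub> st a b"
  and st_smult_right: "\<lbrakk>a \<in> S; b \<in> S\<rbrakk> \<Longrightarrow> st a (r \<odot>\<^bsub>deformed A st\<^esub> b) = r \<odot>\<^bsub>deformed A st\<^esub> st a b"
  using star_linear unfolding bilinear_over_def by (simp_all del: deformed_simps(5,6) add: deformed_simps(1))

lemma series_decomp:
  assumes "a \<in> S"
  shows "a = (\<lambda>k. hm (a 0) k \<oplus> (fps_X \<odot>\<^bsub>deformed A st\<^esub> (\<lambda>k. a (Suc k))) k)"
proof -
  have sh: "(\<lambda>k. a (Suc k)) \<in> S" using assms by (simp add: hseries_def)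
  show ?thesis
    unfolding deformed_smult_X[OF sh] using hseriesD[OF assms]
    by (auto simp: fun_eq_iff hmonom_def split: nat.split)
qed

lemma smult_X_closed: "a \<in> S \<Longrightarrow> fps_X \<odot>\<^bsub>deformed A st\<^esub> a \<in> S"
  by (auto simp: deformed_smult_X hseries_def simp del: deformed_simps split: nat.split)

text \<open>Bilinearity over formal power series already makes the product continuous: each coefficient is
  computed by splitting off the constant terms of the factors.\<close>

lemma st_left_rec:
  assumes "a \<in> S" "b \<in> S"
  shows "st a b n = st (hm (a 0)) b n \<oplus> (case n of 0 \<Rightarrow> \<zero> | Suc m \<Rightarrow> st (\<lambda>k. a (Suc k)) b m)"
proof -
  have sh: "(\<lambda>k. a (Suc k)) \<in> S" using assms(1) by (simp add: hseries_def)
  have "st a b = (\<lambda>k. st (hm (a 0)) b k \<oplus> st (fps_X \<odot>\<^bsub>deformed A st\<^esub> (\<lambda>k. a (Suc k))) b k)"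
    by (subst series_decomp[OF assms(1)], rule st_add_left)
      (intro hm_closed smult_X_closed sh hseriesD[OF assms(1)] assms(2))+
  also have "st (fps_X \<odot>\<^bsub>deformed A st\<^esub> (\<lambda>k. a (Suc k))) b =
      (\<lambda>k. case k of 0 \<Rightarrow> \<zero> | Suc m \<Rightarrow> st (\<lambda>k. a (Suc k)) b m)"
    unfolding st_smult_left[OF sh assms(2)] by (rule deformed_smult_X[OF st_closed[OF sh assms(2)]])
  finally show ?thesis by metis
qed

lemma st_right_rec:
  assumes "a \<in> S" "b \<in> S"
  shows "st b a n = st b (hm (a 0)) n \<oplus> (case n of 0 \<Rightarrow> \<zero> | Suc m \<Rightarrow> st b (\<lambda>k. a (Suc k)) m)"
proof -
  have sh: "(\<lambda>k. a (Suc k)) \<in> S" using assms(1) by (simp add: hseries_def)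
  have "st b a = (\<lambda>k. st b (hm (a 0)) k \<oplus> st b (fps_X \<odot>\<^bsub>deformed A st\<^esub> (\<lambda>k. a (Suc k))) k)"
    by (subst series_decomp[OF assms(1)], rule st_add_right)
      (intro hm_closed smult_X_closed sh hseriesD[OF assms(1)] assms(2))+
  also have "st b (fps_X \<odot>\<^bsub>deformed A st\<^esub> (\<lambda>k. a (Suc k))) =
      (\<lambda>k. case k of 0 \<Rightarrow> \<zero> | Suc m \<Rightarrow> st b (\<lambda>k. a (Suc k)) m)"
    unfolding st_smult_right[OF assms(2) sh] by (rule deformed_smult_X[OF st_closed[OF assms(2) sh]])
  finally show ?thesis by metis
qed

text \<open>The unit axiom covers constant series only; splitting off the constant term extends it
  to all series, one coefficient at a time.\<close>

lemma st_one_left: "a \<in> S \<Longrightarrow> st (hm \<one>) a = a"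
proof
  fix n show "a \<in> S \<Longrightarrow> st (hm \<one>) a n = a n"
  proof (induction n arbitrary: a)
    case (Suc n)
    have "(\<lambda>k. a (Suc k)) \<in> S" using Suc.prems by (simp add: hseries_def)
    with Suc show ?case
      using st_right_rec[OF Suc.prems hm_closed[OF one_closed], of "Suc n"] star_unit[OF hseriesD[OF Suc.prems]]
        hseriesD[OF Suc.prems] by (simp add: hmonom_def)
  next
    case 0
    then show ?case
      using st_right_rec[OF 0 hm_closed[OF one_closed], of 0] star_unit[OF hseriesD[OF 0]] hseriesD[OF 0]
      by simp
  qed
qed

lemma st_one_right: "a \<in> S \<Longrightarrow> st a (hm \<one>) = a"
proof
  fix n show "a \<in> S \<Longrightarrow> st a (hm \<one>) n = a n"
  proof (induction n arbitrary: a)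
    case (Suc n)
    have "(\<lambda>k. a (Suc k)) \<in> S" using Suc.prems by (simp add: hseries_def)
    with Suc show ?case
      using st_left_rec[OF Suc.prems hm_closed[OF one_closed], of "Suc n"] star_unit[OF hseriesD[OF Suc.prems]]
        hseriesD[OF Suc.prems] by (simp add: hmonom_def)
  next
    case 0
    then show ?case
      using st_left_rec[OF 0 hm_closed[OF one_closed], of 0] star_unit[OF hseriesD[OF 0]] hseriesD[OF 0]
      by simp
  qed
qed

lemma deformed_ring: "ring (deformed A st)"
proof (rule ringI)
  show "abelian_group (deformed A st)" by (rule deformed_abelian_group[OF is_abelian_group])
  show "monoid (deformed A st)"
    by (rule monoidI) (auto simp: st_closed hm_closed star_assoc st_one_left st_one_right)
qed (simp_all add: st_add_left st_add_right)

lemma series_ideal_subset: "hseries J \<subseteq> S"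
  using Icarr by (auto simp: hseries_def)

text \<open>Two inductions on the coefficient index. With a constant left factor the recursion runs
  through b and ends in cochains; for general a it runs through a, whose tail is again a series over
  J, and ends in constant left factors.\<close>

lemma st_ideal_left: "a \<in> hseries J \<Longrightarrow> b \<in> S \<Longrightarrow> st a b \<in> hseries J"
proof (rule hseriesI)
  have const: "F \<in> J \<Longrightarrow> b \<in> S \<Longrightarrow> st (hm F) b n \<in> J" for F b n
  proof (induction n arbitrary: b)
    case 0
    then show ?case
      using st_right_rec[OF 0(2) hm_closed[OF Icarr[OF 0(1)]], of 0] cochain_left[OF 0(1) hseriesD[OF 0(2)]]
      by (simp add: a_closed)
  next
    case (Suc n)
    have "(\<lambda>k. b (Suc k)) \<in> S" using Suc.prems by (simp add: hseries_def)
    then show ?case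
      using st_right_rec[OF Suc.prems(2) hm_closed[OF Icarr[OF Suc.prems(1)]], of "Suc n"]
        cochain_left[OF Suc.prems(1) hseriesD[OF Suc.prems(2)]] Suc
      by (simp add: a_closed)
  qed
  fix n show "a \<in> hseries J \<Longrightarrow> b \<in> S \<Longrightarrow> st a b n \<in> J"
  proof (induction n arbitrary: a)
    case 0
    then show ?case
      using st_left_rec[OF subsetD[OF series_ideal_subset 0(1)] 0(2), of 0] const[OF hseriesD[OF 0(1)] 0(2)]
      by (simp add: a_closed)
  next
    case (Suc n)
    have "(\<lambda>k. a (Suc k)) \<in> hseries J" using Suc.prems by (simp add: hseries_def)
    then show ?case
      using st_left_rec[OF subsetD[OF series_ideal_subset Suc.prems(1)] Suc.prems(2), of "Suc n"]
        const[OF hseriesD[OF Suc.prems(1)] Suc.prems(2)] Suc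
      by (simp add: a_closed)
  qed
qed

lemma st_ideal_right: "a \<in> hseries J \<Longrightarrow> b \<in> S \<Longrightarrow> st b a \<in> hseries J"
proof (rule hseriesI)
  have const: "F \<in> J \<Longrightarrow> b \<in> S \<Longrightarrow> st b (hm F) n \<in> J" for F b n
  proof (induction n arbitrary: b)
    case 0
    then show ?case
      using st_left_rec[OF 0(2) hm_closed[OF Icarr[OF 0(1)]], of 0] cochain_right[OF 0(1) hseriesD[OF 0(2)]]
      by (simp add: a_closed)
  next
    case (Suc n)
    have "(\<lambda>k. b (Suc k)) \<in> S" using Suc.prems by (simp add: hseries_def)
    then show ?case
      using st_left_rec[OF Suc.prems(2) hm_closed[OF Icarr[OF Suc.prems(1)]], of "Suc n"]
        cochain_right[OF Suc.prems(1) hseriesD[OF Suc.prems(2)]] Suc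
      by (simp add: a_closed)
  qed
  fix n show "a \<in> hseries J \<Longrightarrow> b \<in> S \<Longrightarrow> st b a n \<in> J"
  proof (induction n arbitrary: a)
    case 0
    then show ?case
      using st_right_rec[OF subsetD[OF series_ideal_subset 0(1)] 0(2), of 0] const[OF hseriesD[OF 0(1)] 0(2)]
      by (simp add: a_closed)
  next
    case (Suc n)
    have "(\<lambda>k. a (Suc k)) \<in> hseries J" using Suc.prems by (simp add: hseries_def)
    then show ?case
      using st_right_rec[OF subsetD[OF series_ideal_subset Suc.prems(1)] Suc.prems(2), of "Suc n"]
        const[OF hseriesD[OF Suc.prems(1)] Suc.prems(2)] Suc
      by (simp add: a_closed)
  qed
qed

lemma finsum_ideal: "(\<And>i. i \<in> I \<Longrightarrow> f i \<in> J) \<Longrightarrow> finsum A f I \<in> J"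
  by (induction I rule: infinite_finite_induct) (auto simp: Pi_def Icarr a_closed)

lemma smult_series_ideal: "a \<in> hseries J \<Longrightarrow> r \<odot>\<^bsub>deformed A st\<^esub> a \<in> hseries J"
  unfolding deformed_simps by (intro hseriesI finsum_ideal smult_ideal[OF ideal_axioms]) (rule hseriesD)

lemma series_algebra_ideal: "algebra_ideal (hseries J) (deformed A st)"
  unfolding algebra_ideal_def
proof (intro conjI allI ballI)
  interpret D: ring "deformed A st" by (rule deformed_ring)
  show "ideal (hseries J) (deformed A st)"
  proof (rule idealI)
    show "ring (deformed A st)" by (rule deformed_ring)
    show "subgroup (hseries J) (add_monoid (deformed A st))"
    proof (rule D.add.subgroupI)
      show "hseries J \<subseteq> carrier (deformed A st)" using series_ideal_subset by simp
      have "(\<lambda>k. \<zero>) \<in> hseries J" by (simp add: hseries_def)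
      then show "hseries J \<noteq> {}" by blast
      fix a assume a: "a \<in> hseries J"
      then have aS: "a \<in> S" using series_ideal_subset by blast
      have "\<ominus>\<^bsub>deformed A st\<^esub> a = (\<lambda>k. \<ominus> a k)"
        by (rule deformed_uminus[OF is_abelian_group aS])
      then show "\<ominus>\<^bsub>deformed A st\<^esub> a \<in> hseries J" using a by (simp add: hseries_def)
      fix b assume "b \<in> hseries J"
      with a show "a \<oplus>\<^bsub>deformed A st\<^esub> b \<in> hseries J" by (simp add: hseries_def a_closed)
    qed
  qed (simp_all add: st_ideal_left st_ideal_right)
qed (rule smult_series_ideal)

end

section \<open>The quotient by a stable ideal\<close>

context star_ideal
begin

abbreviation coset ("\<pi>") where "\<pi> f \<equiv> J +> f"

text \<open>Has the shape of the Whitney algebra over an abstract ideal, as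
  \<open>quotient_bracket\<close> has that of the Whitney bracket, so that the concrete objects are
  recovered by unfolding.\<close>

definition quotient_algebra :: "(complex, 'a set) module" where
  "quotient_algebra =
     \<lparr>carrier = carrier (A Quot J), mult = mult (A Quot J), one = one (A Quot J),
      zero = zero (A Quot J), add = add (A Quot J), smult = (\<lambda>c F. \<Union>f\<in>F. J +> (c \<odot> f))\<rparr>"

definition quotient_bracket :: "'a set \<Rightarrow> 'a set \<Rightarrow> 'a set" where
  "quotient_bracket F G = (\<Union>f\<in>F. \<Union>g\<in>G. J +> br f g)"

abbreviation "E \<equiv> quotient_algebra"

lemma coset_eq_iff: "\<lbrakk>f \<in> carrier A; g \<in> carrier A\<rbrakk> \<Longrightarrow> \<pi> f = \<pi> g \<longleftrightarrow> f \<ominus> g \<in> J"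
  using quotient_eq_iff_same_a_r_cos[OF ideal_axioms] by simp

lemma coset_add_ideal:
  assumes "f \<in> carrier A" "j \<in> J" shows "\<pi> (f \<oplus> j) = \<pi> f"
proof -
  have "(f \<oplus> j) \<ominus> f = j"
    using assms(1) Icarr[OF assms(2)] by (simp add: a_minus_def a_comm[of f j] a_assoc r_neg)
  then show ?thesis using assms Icarr by (simp add: coset_eq_iff)
qed

lemma coset_eqE:
  assumes "\<pi> f = \<pi> g" "f \<in> carrier A" "g \<in> carrier A"
  obtains j where "j \<in> J" "f = g \<oplus> j"
proof
  show "f \<ominus> g \<in> J" using assms coset_eq_iff by blast
  show "f = g \<oplus> (f \<ominus> g)" using assms(2,3) by (simp add: a_minus_def a_lcomm r_neg)
qed

lemma coset_eq_ideal_iff: "f \<in> carrier A \<Longrightarrow> \<pi> f = J \<longleftrightarrow> f \<in> J"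
  using a_rcos_const a_rcos_self by blast

lemma coset_memD:
  assumes "f' \<in> \<pi> f" "f \<in> carrier A"
  shows "f' \<in> carrier A" "\<pi> f' = \<pi> f"
  using assms a_r_coset_subset_G[OF a_subset] a_repr_independence' by blast+

text \<open>Scalar multiplication and bracket on cosets are unions over representatives. Once the
  value does not depend on the representative, such a union collapses to it, because a coset is
  never empty.\<close>

lemma Union_coset_const:
  assumes "f \<in> carrier A" "\<And>f'. f' \<in> carrier A \<Longrightarrow> \<pi> f' = \<pi> f \<Longrightarrow> h f' = h f"
  shows "(\<Union>f'\<in>\<pi> f. h f') = h f"
proof -
  have "h f' = h f" if "f' \<in> \<pi> f" for f'
    using coset_memD[OF that assms(1)] by (rule assms(2))
  then have "(\<Union>f'\<in>\<pi> f. h f') = (\<Union>f'\<in>\<pi> f. h f)" by (rule SUP_cong[OF refl])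
  moreover have "\<pi> f \<noteq> {}" using a_rcos_self[OF assms(1)] by (metis empty_iff)
  ultimately show ?thesis by (simp only: UN_constant if_False)
qed

lemma quotient_carrier: "carrier E = \<pi> ` carrier A"
  by (auto simp: quotient_algebra_def FactRing_def A_RCOSETS_def')

lemma coset_closed [simp]: "f \<in> carrier A \<Longrightarrow> \<pi> f \<in> carrier E"
  by (simp add: quotient_carrier)

lemma quotient_add [simp]: "\<lbrakk>f \<in> carrier A; g \<in> carrier A\<rbrakk> \<Longrightarrow> \<pi> f \<oplus>\<^bsub>E\<^esub> \<pi> g = \<pi> (f \<oplus> g)"
  by (simp add: quotient_algebra_def FactRing_def a_rcos_sum)

lemma quotient_mult [simp]: "\<lbrakk>f \<in> carrier A; g \<in> carrier A\<rbrakk> \<Longrightarrow> \<pi> f \<otimes>\<^bsub>E\<^esub> \<pi> g = \<pi> (f \<otimes> g)"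
  by (simp add: quotient_algebra_def FactRing_def rcoset_mult_add)

lemma quotient_one [simp]: "\<one>\<^bsub>E\<^esub> = \<pi> \<one>"
  by (simp add: quotient_algebra_def FactRing_def)

lemma quotient_zero: "\<zero>\<^bsub>E\<^esub> = J"
  by (simp add: quotient_algebra_def FactRing_def)

lemma quotient_zero_coset: "\<zero>\<^bsub>E\<^esub> = \<pi> \<zero>"
  by (simp add: quotient_zero a_rcos_const additive_subgroup.zero_closed[OF additive_subgroup_axioms])

lemma quotient_smult [simp]: "f \<in> carrier A \<Longrightarrow> c \<odot>\<^bsub>E\<^esub> \<pi> f = \<pi> (c \<odot> f)"
  unfolding quotient_algebra_def module.simps
proof (rule Union_coset_const)
  fix f' assume f: "f \<in> carrier A" "f' \<in> carrier A" "\<pi> f' = \<pi> f"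
  then obtain j where j: "j \<in> J" "f' = f \<oplus> j" by (metis coset_eqE)
  then show "\<pi> (c \<odot> f') = \<pi> (c \<odot> f)"
    using f(1) by (simp add: smult_add Icarr smult_closed coset_add_ideal smult_ideal[OF ideal_axioms])
qed

lemma quotientE:
  assumes "F \<in> carrier E" obtains f where "f \<in> carrier A" "F = \<pi> f"
  using assms unfolding quotient_carrier by blast

lemma quotient_abelian_group: "abelian_group E"
proof (rule abelian_groupI)
  show "\<zero>\<^bsub>E\<^esub> \<in> carrier E" by (simp add: quotient_zero_coset)
next
  fix F G assume "F \<in> carrier E" "G \<in> carrier E"
  then show "F \<oplus>\<^bsub>E\<^esub> G \<in> carrier E" "F \<oplus>\<^bsub>E\<^esub> G = G \<oplus>\<^bsub>E\<^esub> F"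
    by (auto elim!: quotientE simp: a_comm)
next
  fix F G H assume "F \<in> carrier E" "G \<in> carrier E" "H \<in> carrier E"
  then show "F \<oplus>\<^bsub>E\<^esub> G \<oplus>\<^bsub>E\<^esub> H = F \<oplus>\<^bsub>E\<^esub> (G \<oplus>\<^bsub>E\<^esub> H)"
    by (auto elim!: quotientE simp: a_assoc)
next
  fix F assume "F \<in> carrier E"
  then obtain f where f: "f \<in> carrier A" "F = \<pi> f" by (rule quotientE)
  then show "\<zero>\<^bsub>E\<^esub> \<oplus>\<^bsub>E\<^esub> F = F" by (simp add: quotient_zero_coset)
  show "\<exists>G\<in>carrier E. G \<oplus>\<^bsub>E\<^esub> F = \<zero>\<^bsub>E\<^esub>"
    using f by (intro bexI[of _ "\<pi> (\<ominus> f)"]) (simp_all add: quotient_zero_coset l_neg)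
qed

lemma quotient_uminus: "f \<in> carrier A \<Longrightarrow> \<ominus>\<^bsub>E\<^esub> \<pi> f = \<pi> (\<ominus> f)"
  by (rule abelian_group.minus_equality[OF quotient_abelian_group])
    (simp_all add: quotient_zero_coset l_neg)

lemma quotient_finsum:
  "finite I \<Longrightarrow> (\<And>i. i \<in> I \<Longrightarrow> f i \<in> carrier A) \<Longrightarrow> finsum E (\<lambda>i. \<pi> (f i)) I = \<pi> (finsum A f I)"
proof (induction I rule: finite_induct)
  interpret E: abelian_group E by (rule quotient_abelian_group)
  case empty
  show ?case by (simp add: quotient_zero_coset)
next
  interpret E: abelian_group E by (rule quotient_abelian_group)
  case (insert i I)
  then show ?case by (simp add: E.finsum_insert finsum_insert Pi_def)
qed

definition rep :: "'a set \<Rightarrow> 'a" where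
  "rep F = (SOME f. f \<in> carrier A \<and> \<pi> f = F)"

lemma rep: "F \<in> carrier E \<Longrightarrow> rep F \<in> carrier A" "F \<in> carrier E \<Longrightarrow> \<pi> (rep F) = F"
proof -
  have "F \<in> carrier E \<Longrightarrow> rep F \<in> carrier A \<and> \<pi> (rep F) = F"
    unfolding rep_def by (rule someI_ex) (auto simp: quotient_carrier)
  then show "F \<in> carrier E \<Longrightarrow> rep F \<in> carrier A" "F \<in> carrier E \<Longrightarrow> \<pi> (rep F) = F" by auto
qed

text \<open>One argument is exchanged at a time, and each difference lands in J. Serves both the
  bracket and the individual cochains.\<close>

lemma biadditive_descends:
  assumes closed: "\<And>f g. \<lbrakk>f \<in> carrier A; g \<in> carrier A\<rbrakk> \<Longrightarrow> p f g \<in> carrier A"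
    and add: "\<And>f f' g. \<lbrakk>f \<in> carrier A; f' \<in> carrier A; g \<in> carrier A\<rbrakk> \<Longrightarrow>
      p (f \<oplus> f') g = p f g \<oplus> p f' g \<and> p g (f \<oplus> f') = p g f \<oplus> p g f'"
    and ideal: "\<And>f g. \<lbrakk>f \<in> J; g \<in> carrier A\<rbrakk> \<Longrightarrow> p f g \<in> J \<and> p g f \<in> J"
    and f: "f \<in> carrier A" "f' \<in> carrier A" "\<pi> f = \<pi> f'"
    and g: "g \<in> carrier A" "g' \<in> carrier A" "\<pi> g = \<pi> g'"
  shows "\<pi> (p f g) = \<pi> (p f' g')"
proof -
  obtain i where i: "i \<in> J" "f = f' \<oplus> i" using f by (metis coset_eqE)
  obtain j where j: "j \<in> J" "g = g' \<oplus> j" using g by (metis coset_eqE)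
  have "p f g = p f' g \<oplus> p i g" using add[OF f(2) Icarr[OF i(1)] g(1)] i(2) by simp
  also have "p f' g = p f' g' \<oplus> p f' j" using add[OF g(2) Icarr[OF j(1)] f(2)] j(2) by simp
  finally show ?thesis
    using ideal[OF i(1) g(1)] ideal[OF j(1) f(2)] closed f(2) g(2)
    by (simp add: coset_add_ideal Icarr)
qed

lemma br_closed: "\<lbrakk>f \<in> carrier A; g \<in> carrier A\<rbrakk> \<Longrightarrow> br f g \<in> carrier A"
  using br_bilinear unfolding bilinear_over_def by blast

lemma br_ideal:
  assumes F: "F \<in> J" and G: "G \<in> carrier A"
  shows "br F G \<in> J" "br G F \<in> J"
proof -
  have *: "br F G \<in> J" if FG: "F \<in> carrier A" "G \<in> carrier A"
    and J: "st (hm F) (hm G) 1 \<in> J" "st (hm G) (hm F) 1 \<in> J" for F G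
  proof -
    have "hcong 2 (st (hm F) (hm G) \<ominus>\<^bsub>deformed A st\<^esub> st (hm G) (hm F)) (hmonom A 1 ((- \<i>) \<odot> br F G))"
      using star_commutator FG by simp
    \<comment> \<open>This is coefficient 1 of the congruence modulo \<hbar>^2; the factor - \<i> is
      undone below by multiplying with \<i>.\<close>
    then have "(- \<i>) \<odot> br F G = st (hm F) (hm G) 1 \<ominus> st (hm G) (hm F) 1"
      by (simp add: hcong_def a_minus_def deformed_uminus[OF is_abelian_group] st_closed hm_closed FG)
    also have "\<dots> \<in> J"
      using J by (simp add: a_minus_def a_closed additive_subgroup.a_inv_closed[OF additive_subgroup_axioms])
    finally have "\<i> \<odot> ((- \<i>) \<odot> br F G) \<in> J" by (rule smult_ideal[OF ideal_axioms])
    then show ?thesis using br_closed FG by (simp add: smult_smult smult_one)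
  qed
  show "br F G \<in> J" "br G F \<in> J"
    using *[of F G] *[of G F] Icarr[OF F] G cochain_left[OF F G] cochain_right[OF F G] by auto
qed

lemma br_add:
  "\<lbrakk>f \<in> carrier A; f' \<in> carrier A; g \<in> carrier A\<rbrakk> \<Longrightarrow>
    br (f \<oplus> f') g = br f g \<oplus> br f' g \<and> br g (f \<oplus> f') = br g f \<oplus> br g f'"
  using br_bilinear unfolding bilinear_over_def by blast

lemma br_smult:
  "\<lbrakk>f \<in> carrier A; g \<in> carrier A\<rbrakk> \<Longrightarrow> br (r \<odot> f) g = r \<odot> br f g \<and> br f (r \<odot> g) = r \<odot> br f g"
  using br_bilinear unfolding bilinear_over_def by blast

lemma quotient_bracket_coset [simp]:
  assumes "f \<in> carrier A" "g \<in> carrier A"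
  shows "quotient_bracket (\<pi> f) (\<pi> g) = \<pi> (br f g)"
proof -
  have eq: "\<pi> (br f' g') = \<pi> (br f g)"
    if "f' \<in> carrier A" "\<pi> f' = \<pi> f" "g' \<in> carrier A" "\<pi> g' = \<pi> g" for f' g'
    by (rule biadditive_descends[of br, OF br_closed br_add _ that(1) assms(1) that(2,3) assms(2) that(4)])
      (simp_all add: br_ideal)
  have "(\<Union>g'\<in>\<pi> g. \<pi> (br f' g')) = \<pi> (br f g)" if "f' \<in> carrier A" "\<pi> f' = \<pi> f" for f'
  proof -
    have "(\<Union>g'\<in>\<pi> g. \<pi> (br f' g')) = \<pi> (br f' g)"
      by (rule Union_coset_const[OF assms(2)], rule trans[OF eq[OF that] eq[OF that assms(2) refl, symmetric]])
    then show ?thesis unfolding eq[OF that assms(2) refl] .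
  qed
  then show ?thesis
    unfolding quotient_bracket_def
    by (intro Union_coset_const[OF assms(1), THEN trans]) (simp_all only: assms refl)
qed

lemma quotient_whitney_poisson: "whitney_poisson E quotient_bracket"
proof
  show "bilinear_over UNIV E quotient_bracket"
    unfolding bilinear_over_def
    by (auto elim!: quotientE simp: br_closed br_add br_smult smult_closed)
next
  fix F G assume "F \<in> carrier E" "G \<in> carrier E"
  then show "quotient_bracket F G = \<ominus>\<^bsub>E\<^esub> quotient_bracket G F"
    by (auto elim!: quotientE simp: quotient_uminus br_closed simp flip: br_antisym)
next
  fix F G H assume "F \<in> carrier E" "G \<in> carrier E" "H \<in> carrier E"
  then obtain f g h where "f \<in> carrier A" "F = \<pi> f" "g \<in> carrier A" "G = \<pi> g" "h \<in> carrier A" "H = \<pi> h"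
    by (metis quotientE)
  then show "quotient_bracket F (G \<otimes>\<^bsub>E\<^esub> H) =
      quotient_bracket F G \<otimes>\<^bsub>E\<^esub> H \<oplus>\<^bsub>E\<^esub> G \<otimes>\<^bsub>E\<^esub> quotient_bracket F H"
    and "quotient_bracket F (quotient_bracket G H) \<oplus>\<^bsub>E\<^esub> quotient_bracket G (quotient_bracket H F) \<oplus>\<^bsub>E\<^esub>
      quotient_bracket H (quotient_bracket F G) = \<zero>\<^bsub>E\<^esub>"
    by (simp_all add: br_closed br_leibniz br_jacobi quotient_zero_coset)
qed

section \<open>The induced star product and the exact sequence\<close>

definition series_coset :: "(nat \<Rightarrow> 'a) \<Rightarrow> nat \<Rightarrow> 'a set" where
  "series_coset a = (\<lambda>k. \<pi> (a k))"

text \<open>Representatives are chosen coefficient by coefficient, so series that agree up to some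
  order have representatives that agree up to the same order. This transfers continuity to the
  quotient with the same m.\<close>

definition quotient_star :: "(nat \<Rightarrow> 'a set) \<Rightarrow> (nat \<Rightarrow> 'a set) \<Rightarrow> nat \<Rightarrow> 'a set" where
  "quotient_star a b = series_coset (st (\<lambda>k. rep (a k)) (\<lambda>k. rep (b k)))"

lemma series_coset_closed: "a \<in> S \<Longrightarrow> series_coset a \<in> hseries (carrier E)"
  by (simp add: hseries_def series_coset_def)

lemma rep_series:
  assumes "a \<in> hseries (carrier E)"
  shows "(\<lambda>k. rep (a k)) \<in> S" "series_coset (\<lambda>k. rep (a k)) = a"
  using assms rep by (auto simp: hseries_def series_coset_def)

lemma series_quotientE:
  assumes "a \<in> hseries (carrier E)" obtains a' where "a' \<in> S" "a = series_coset a'"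
  using rep_series[OF assms] by metis

lemma series_coset_eqE:
  assumes "series_coset a = series_coset b" "a \<in> S" "b \<in> S"
  obtains j where "j \<in> hseries J" "a = (\<lambda>k. b k \<oplus> j k)"
proof
  have eq: "\<pi> (a k) = \<pi> (b k)" for k using assms(1) unfolding series_coset_def by metis
  show "(\<lambda>k. a k \<ominus> b k) \<in> hseries J"
    using eq assms(2,3) coset_eq_iff by (auto simp: hseries_def)
  show "a = (\<lambda>k. b k \<oplus> (a k \<ominus> b k))"
    using assms(2,3) by (auto simp: hseries_def a_minus_def a_lcomm r_neg)
qed

lemma series_coset_add_ideal: "a \<in> S \<Longrightarrow> j \<in> hseries J \<Longrightarrow> series_coset (\<lambda>k. a k \<oplus> j k) = series_coset a"
  unfolding series_coset_def using coset_add_ideal hseriesD by metis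

text \<open>Exchanging the representative of one factor alters the product by a series over J, since
  these series form a two-sided ideal. Through this rule the axioms for cosets reduce to those for
  representatives.\<close>

lemma quotient_star_coset [simp]:
  assumes a: "a \<in> S" and b: "b \<in> S"
  shows "quotient_star (series_coset a) (series_coset b) = series_coset (st a b)"
proof -
  let ?a = "\<lambda>k. rep (series_coset a k)" and ?b = "\<lambda>k. rep (series_coset b k)"
  have a': "?a \<in> S" "series_coset ?a = series_coset a" and b': "?b \<in> S" "series_coset ?b = series_coset b"
    using rep_series series_coset_closed a b by blast+
  obtain i where i: "i \<in> hseries J" "?a = (\<lambda>k. a k \<oplus> i k)" using series_coset_eqE[OF a'(2,1) a] .
  obtain j where j: "j \<in> hseries J" "?b = (\<lambda>k. b k \<oplus> j k)" using series_coset_eqE[OF b'(2,1) b] .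
  have iS: "i \<in> S" "j \<in> S" using i(1) j(1) series_ideal_subset by blast+
  have 1: "st ?a ?b = (\<lambda>k. st a ?b k \<oplus> st i ?b k)"
    by (subst i(2)) (rule st_add_left[OF a iS(1) b'(1)])
  have 2: "st a ?b = (\<lambda>k. st a b k \<oplus> st a j k)"
    by (subst j(2)) (rule st_add_right[OF b iS(2) a])
  have "series_coset (st ?a ?b) = series_coset (st a ?b)"
    unfolding 1 by (rule series_coset_add_ideal[OF st_closed[OF a b'(1)] st_ideal_left[OF i(1) b'(1)]])
  also have "\<dots> = series_coset (st a b)"
    unfolding 2 by (rule series_coset_add_ideal[OF st_closed[OF a b] st_ideal_right[OF j(1) a]])
  finally show ?thesis by (simp add: quotient_star_def)
qed

lemma series_coset_hmonom: "f \<in> carrier A \<Longrightarrow> hmonom E n (\<pi> f) = series_coset (hmonom A n f)"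
  by (rule ext) (simp add: hmonom_def series_coset_def quotient_zero_coset)

text \<open>\<open>st\<close> and \<open>st'\<close> are unrelated because the additive structure of
  series does not involve the product.\<close>

lemma series_coset_add:
  "\<lbrakk>a \<in> S; b \<in> S\<rbrakk> \<Longrightarrow> series_coset a \<oplus>\<^bsub>deformed E st'\<^esub> series_coset b = series_coset (a \<oplus>\<^bsub>deformed A st\<^esub> b)"
  by (simp add: series_coset_def hseries_def)

lemma series_coset_uminus:
  assumes "a \<in> S"
  shows "\<ominus>\<^bsub>deformed E st'\<^esub> series_coset a = series_coset (\<ominus>\<^bsub>deformed A st\<^esub> a)"
  unfolding deformed_uminus[OF quotient_abelian_group series_coset_closed[OF assms]]
    deformed_uminus[OF is_abelian_group assms]
  using assms by (simp add: series_coset_def hseries_def quotient_uminus)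

lemma series_coset_smult:
  assumes "a \<in> S"
  shows "r \<odot>\<^bsub>deformed E st'\<^esub> series_coset a = series_coset (r \<odot>\<^bsub>deformed A st\<^esub> a)"
  using assms
  by (simp add: series_coset_def hseries_def quotient_finsum smult_closed)

lemma smult_series_closed: "a \<in> S \<Longrightarrow> r \<odot>\<^bsub>deformed A st\<^esub> a \<in> S"
  by (auto simp: hseries_def smult_closed intro!: finsum_closed)

lemma quotient_star_product: "star_product E quotient_bracket quotient_star"
proof (intro star_product.intro star_product_axioms.intro quotient_whitney_poisson)
  fix a b c assume "a \<in> hseries (carrier E)" "b \<in> hseries (carrier E)" "c \<in> hseries (carrier E)"
  then show "quotient_star (quotient_star a b) c = quotient_star a (quotient_star b c)"
    by (auto elim!: series_quotientE simp: st_closed star_assoc)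
next
  have D_add: "st (a \<oplus>\<^bsub>deformed A st\<^esub> a') b = st a b \<oplus>\<^bsub>deformed A st\<^esub> st a' b"
    "st b (a \<oplus>\<^bsub>deformed A st\<^esub> a') = st b a \<oplus>\<^bsub>deformed A st\<^esub> st b a'"
    "a \<oplus>\<^bsub>deformed A st\<^esub> a' \<in> S"
    if "a \<in> S" "a' \<in> S" "b \<in> S" for a a' b
    using that by (simp_all add: st_add_left st_add_right add_series_closed)
  show "bilinear_over UNIV (deformed E quotient_star) quotient_star"
    unfolding bilinear_over_def deformed_simps(1)
    by (auto elim!: series_quotientE simp del: deformed_simps
        simp: series_coset_closed st_closed series_coset_add series_coset_smult smult_series_closed
          D_add st_smult_left st_smult_right)
next
  fix a b assume a: "a \<in> hseries (carrier E)" and b: "b \<in> hseries (carrier E)"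
  show "\<forall>n. \<exists>m. \<forall>b'\<in>hseries (carrier E). hcong m b b' \<longrightarrow> hcong n (quotient_star a b) (quotient_star a b')"
  proof
    fix n
    obtain m where m: "\<And>b'. b' \<in> S \<Longrightarrow> hcong m (\<lambda>k. rep (b k)) b' \<Longrightarrow>
        hcong n (st (\<lambda>k. rep (a k)) (\<lambda>k. rep (b k))) (st (\<lambda>k. rep (a k)) b')"
      using star_continuous_right[OF rep_series(1)[OF a] rep_series(1)[OF b]] by blast
    have "hcong n (quotient_star a b) (quotient_star a b')"
      if "b' \<in> hseries (carrier E)" "hcong m b b'" for b'
      using m[OF rep_series(1)[OF that(1)]] that(2)
      by (simp add: hcong_def quotient_star_def series_coset_def)
    then show "\<exists>m. \<forall>b'\<in>hseries (carrier E). hcong m b b' \<longrightarrow> hcong n (quotient_star a b) (quotient_star a b')"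
      by blast
  qed
  show "\<forall>n. \<exists>m. \<forall>a'\<in>hseries (carrier E). hcong m a a' \<longrightarrow> hcong n (quotient_star a b) (quotient_star a' b)"
  proof
    fix n
    obtain m where m: "\<And>a'. a' \<in> S \<Longrightarrow> hcong m (\<lambda>k. rep (a k)) a' \<Longrightarrow>
        hcong n (st (\<lambda>k. rep (a k)) (\<lambda>k. rep (b k))) (st a' (\<lambda>k. rep (b k)))"
      using star_continuous_left[OF rep_series(1)[OF a] rep_series(1)[OF b]] by blast
    have "hcong n (quotient_star a b) (quotient_star a' b)"
      if "a' \<in> hseries (carrier E)" "hcong m a a'" for a'
      using m[OF rep_series(1)[OF that(1)]] that(2)
      by (simp add: hcong_def quotient_star_def series_coset_def)
    then show "\<exists>m. \<forall>a'\<in>hseries (carrier E). hcong m a a' \<longrightarrow> hcong n (quotient_star a b) (quotient_star a' b)"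
      by blast
  qed
next
  obtain c where c: "\<And>k. bilinear_over \<real> A (c k)"
    "\<And>F G. F \<in> carrier A \<Longrightarrow> G \<in> carrier A \<Longrightarrow> c 0 F G = F \<otimes> G"
    "\<And>F G. F \<in> carrier A \<Longrightarrow> G \<in> carrier A \<Longrightarrow> st (hm F) (hm G) = (\<lambda>k. c k F G)"
    using star_expansion by blast
  have cc: "F \<in> carrier A \<Longrightarrow> G \<in> carrier A \<Longrightarrow> c k F G \<in> carrier A" for F G k
    using c(1) unfolding bilinear_over_def by blast
  have ca: "F \<in> carrier A \<Longrightarrow> F' \<in> carrier A \<Longrightarrow> G \<in> carrier A \<Longrightarrow>
      c k (F \<oplus> F') G = c k F G \<oplus> c k F' G \<and> c k G (F \<oplus> F') = c k G F \<oplus> c k G F'" for F F' G k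
    using c(1) unfolding bilinear_over_def by blast
  have cs: "r \<in> \<real> \<Longrightarrow> F \<in> carrier A \<Longrightarrow> G \<in> carrier A \<Longrightarrow>
      c k (r \<odot> F) G = r \<odot> c k F G \<and> c k F (r \<odot> G) = r \<odot> c k F G" for F G k r
    using c(1) unfolding bilinear_over_def by blast
  have ci: "F \<in> J \<Longrightarrow> G \<in> carrier A \<Longrightarrow> c k F G \<in> J \<and> c k G F \<in> J" for F G k
    using cochain_left[of F G k] cochain_right[of F G k] by (simp add: c(3) Icarr)
  \<comment> \<open>The cochains on cosets, defined through chosen representatives;
    \<open>biadditive_descends\<close> makes the choice irrelevant, and bilinearity follows from
    that.\<close>
  define d where "d = (\<lambda>k F G. \<pi> (c k (rep F) (rep G)))"
  have d: "d k (\<pi> f) (\<pi> g) = \<pi> (c k f g)" if "f \<in> carrier A" "g \<in> carrier A" for k f g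
    unfolding d_def
    by (rule biadditive_descends[of "c k", OF cc ca ci])
      (use that rep[OF coset_closed] in auto)
  have "bilinear_over \<real> E (d k)" for k
    unfolding bilinear_over_def
    by (auto elim!: quotientE simp: d cc ca cs smult_closed)
  moreover have "\<forall>F\<in>carrier E. \<forall>G\<in>carrier E. d 0 F G = F \<otimes>\<^bsub>E\<^esub> G"
    by (auto elim!: quotientE simp: d c(2))
  moreover have "\<forall>F\<in>carrier E. \<forall>G\<in>carrier E. quotient_star (hmonom E 0 F) (hmonom E 0 G) = (\<lambda>k. d k F G)"
  proof (intro ballI)
    fix F G assume "F \<in> carrier E" "G \<in> carrier E"
    then obtain f g where "f \<in> carrier A" "F = \<pi> f" "g \<in> carrier A" "G = \<pi> g" by (metis quotientE)
    then show "quotient_star (hmonom E 0 F) (hmonom E 0 G) = (\<lambda>k. d k F G)"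
      by (simp add: series_coset_hmonom hm_closed c(3) d) (simp add: series_coset_def)
  qed
  ultimately show "\<exists>c. (\<forall>k. bilinear_over \<real> E (c k)) \<and>
         (\<forall>F\<in>carrier E. \<forall>G\<in>carrier E. c 0 F G = F \<otimes>\<^bsub>E\<^esub> G) \<and>
         (\<forall>F\<in>carrier E. \<forall>G\<in>carrier E. quotient_star (hmonom E 0 F) (hmonom E 0 G) = (\<lambda>k. c k F G))"
    by blast
next
  fix F assume "F \<in> carrier E"
  then show "quotient_star (hmonom E 0 \<one>\<^bsub>E\<^esub>) (hmonom E 0 F) = hmonom E 0 F \<and>
      quotient_star (hmonom E 0 F) (hmonom E 0 \<one>\<^bsub>E\<^esub>) = hmonom E 0 F"
    by (auto elim!: quotientE simp: series_coset_hmonom hm_closed star_unit)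
next
  fix F G assume "F \<in> carrier E" "G \<in> carrier E"
  then obtain f g where f: "f \<in> carrier A" "F = \<pi> f" and g: "g \<in> carrier A" "G = \<pi> g" by (metis quotientE)
  let ?u = "st (hm f) (hm g)" and ?v = "st (hm g) (hm f)"
  have uv: "?u \<in> S" "?v \<in> S" using f g by (simp_all add: st_closed hm_closed)
  have v: "\<ominus>\<^bsub>deformed A st\<^esub> ?v \<in> S"
    using uv(2) by (simp add: deformed_uminus[OF is_abelian_group] hseries_def)
  have "quotient_star (hmonom E 0 F) (hmonom E 0 G) \<ominus>\<^bsub>deformed E quotient_star\<^esub>
      quotient_star (hmonom E 0 G) (hmonom E 0 F) = series_coset (?u \<ominus>\<^bsub>deformed A st\<^esub> ?v)"
    unfolding a_minus_def f(2) g(2)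
    using f(1) g(1) uv v
    by (simp del: deformed_simps add: series_coset_hmonom hm_closed series_coset_uminus series_coset_add)
  moreover have "hmonom E 1 ((- \<i>) \<odot>\<^bsub>E\<^esub> quotient_bracket F G) =
      series_coset (hmonom A 1 ((- \<i>) \<odot> br f g))"
    using f g by (simp add: br_closed smult_closed series_coset_hmonom)
  moreover have "hcong 2 (?u \<ominus>\<^bsub>deformed A st\<^esub> ?v) (hmonom A 1 ((- \<i>) \<odot> br f g))"
    using star_commutator f(1) g(1) by blast
  ultimately show "hcong 2 (quotient_star (hmonom E 0 F) (hmonom E 0 G) \<ominus>\<^bsub>deformed E quotient_star\<^esub>
      quotient_star (hmonom E 0 G) (hmonom E 0 F)) (hmonom E 1 ((- \<i>) \<odot>\<^bsub>E\<^esub> quotient_bracket F G))"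
    by (simp add: hcong_def series_coset_def)
qed

lemma series_short_exact:
  "short_exact ((deformed A st)\<lparr>carrier := hseries J\<rparr>) (deformed A st) (deformed E quotient_star)
    (\<lambda>a. a) series_coset"
  unfolding short_exact_def
proof (intro conjI)
  show "algebra_hom ((deformed A st)\<lparr>carrier := hseries J\<rparr>) (deformed A st) (\<lambda>a. a)"
    using series_ideal_subset by (auto simp: algebra_hom_def)
  show "algebra_hom (deformed A st) (deformed E quotient_star) series_coset"
    unfolding algebra_hom_def deformed_simps(1,2)
    by (simp del: deformed_simps add: Pi_def series_coset_closed series_coset_add
        series_coset_smult)
  \<comment> \<open>The zero of the quotient is the coset J itself, so the kernel is read off
    coefficientwise.\<close>
  have "series_coset a = (\<lambda>k. J) \<longleftrightarrow> a \<in> hseries J" if "a \<in> S" for a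
    using that coset_eq_ideal_iff by (auto simp: series_coset_def hseries_def fun_eq_iff)
  then show "(\<lambda>a. a) ` carrier ((deformed A st)\<lparr>carrier := hseries J\<rparr>) =
      a_kernel (deformed A st) (deformed E quotient_star) series_coset"
    using series_ideal_subset by (auto simp: a_kernel_def' quotient_zero)
  show "series_coset ` carrier (deformed A st) = carrier (deformed E quotient_star)"
    using series_coset_closed by (auto elim: series_quotientE)
qed simp

end

section \<open>The algebra of Whitney functions\<close>

lemma smooth_algebra_simps [simp]:
  "carrier (smooth_algebra atlas) = smooth_functions atlas"
  "mult (smooth_algebra atlas) f g = (\<lambda>x. f x * g x)" "one (smooth_algebra atlas) = (\<lambda>x. 1)"
  "zero (smooth_algebra atlas) = (\<lambda>x. 0)" "add (smooth_algebra atlas) f g = (\<lambda>x. f x + g x)"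
  "smult (smooth_algebra atlas) c f = (\<lambda>x. c * f x)"
  by (simp_all add: smooth_algebra_def)

context manifold_with_frame
begin

lemma smooth_algebra_complex_comm_algebra: "complex_comm_algebra (smooth_algebra atlas)"
proof (intro complex_comm_algebra.intro complex_comm_algebra_axioms.intro)
  show "cring (smooth_algebra atlas)"
  proof (intro cringI abelian_groupI comm_monoidI)
    fix f assume "f \<in> carrier (smooth_algebra atlas)"
    then show "\<exists>g\<in>carrier (smooth_algebra atlas). g \<oplus>\<^bsub>smooth_algebra atlas\<^esub> f = \<zero>\<^bsub>smooth_algebra atlas\<^esub>"
      using smooth_functions_mult[OF smooth_functions_const[of "-1"]]
      by (intro bexI[of _ "\<lambda>x. - 1 * f x"]) auto
  qed (auto simp: smooth_functions_add smooth_functions_mult smooth_functions_const algebra_simps)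
qed (auto simp: smooth_functions_mult smooth_functions_const)

lemma flat_ideal_is_ideal: "ideal (flat_ideal atlas X) (smooth_algebra atlas)"
proof -
  interpret complex_comm_algebra "smooth_algebra atlas"
    by (rule smooth_algebra_complex_comm_algebra)
  show ?thesis
  proof (rule idealI)
    show "ring (smooth_algebra atlas)" by (rule ring_axioms)
    show "subgroup (flat_ideal atlas X) (add_monoid (smooth_algebra atlas))"
    proof (rule add.subgroupI)
      show "flat_ideal atlas X \<subseteq> carrier (smooth_algebra atlas)" using flat_ideal_smooth by auto
      show "flat_ideal atlas X \<noteq> {}" using flat_ideal_zero by blast
      fix f assume f: "f \<in> flat_ideal atlas X"
      have m: "(\<lambda>x. f x * - 1) \<in> flat_ideal atlas X"
        by (rule flat_ideal_mult[OF f smooth_functions_const])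
      have "\<ominus>\<^bsub>smooth_algebra atlas\<^esub> f = (\<lambda>x. f x * - 1)"
        using f m flat_ideal_smooth by (intro minus_equality) auto
      then show "\<ominus>\<^bsub>smooth_algebra atlas\<^esub> f \<in> flat_ideal atlas X" using m by simp
      fix g assume "g \<in> flat_ideal atlas X"
      with f show "f \<oplus>\<^bsub>smooth_algebra atlas\<^esub> g \<in> flat_ideal atlas X"
        by (simp add: flat_ideal_add)
    qed
  next
    fix f g assume "f \<in> flat_ideal atlas X" "g \<in> carrier (smooth_algebra atlas)"
    from flat_ideal_mult[of f X g] this
    show "f \<otimes>\<^bsub>smooth_algebra atlas\<^esub> g \<in> flat_ideal atlas X"
      and "g \<otimes>\<^bsub>smooth_algebra atlas\<^esub> f \<in> flat_ideal atlas X"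
      by (simp_all add: mult.commute)
  qed
qed

text \<open>With one argument fixed, each cochain is additive and vanishes off the support of the
  other argument, so it is a local operator in the sense above. The expansion in cochains provides
  additivity for every coefficient separately.\<close>

lemma local_star_product_star_ideal:
  assumes "local_star_product atlas P st"
  shows "star_ideal (smooth_algebra atlas) (poisson_bracket atlas P) st (flat_ideal atlas X)"
proof -
  let ?C = "smooth_algebra atlas"
  have sp: "star_product ?C (poisson_bracket atlas P) st"
    and loc: "\<And>F G. F \<in> smooth_functions atlas \<Longrightarrow> G \<in> smooth_functions atlas \<Longrightarrow>
      supp_series (st (hmonom ?C 0 F) (hmonom ?C 0 G)) \<subseteq> supp F \<inter> supp G"
    using assms by (simp_all add: local_star_product_def Let_def)
  obtain c where c_all: "\<forall>k. bilinear_over \<real> ?C (c k)"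
    "\<forall>F\<in>smooth_functions atlas. \<forall>G\<in>smooth_functions atlas.
      st (hmonom ?C 0 F) (hmonom ?C 0 G) = (\<lambda>k. c k F G)"
    using star_product.star_expansion[OF sp] unfolding smooth_algebra_simps by blast
  then have c: "\<And>k. bilinear_over \<real> ?C (c k)"
    "\<And>F G. F \<in> smooth_functions atlas \<Longrightarrow> G \<in> smooth_functions atlas \<Longrightarrow>
      st (hmonom ?C 0 F) (hmonom ?C 0 G) = (\<lambda>k. c k F G)"
    by blast+
  have closed: "c k F G \<in> smooth_functions atlas"
    if "F \<in> smooth_functions atlas" "G \<in> smooth_functions atlas" for k F G
    using c(1)[of k] that unfolding bilinear_over_def by simp
  have add: "c k (\<lambda>x. F x + F' x) G x = c k F G x + c k F' G x"
    "c k G (\<lambda>x. F x + F' x) x = c k G F x + c k G F' x"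
    if "F \<in> smooth_functions atlas" "F' \<in> smooth_functions atlas" "G \<in> smooth_functions atlas" for k F F' G x
    using c(1)[of k] that unfolding bilinear_over_def by simp_all
  have zero: "c k F G x = 0"
    if "F \<in> smooth_functions atlas" "G \<in> smooth_functions atlas" "x \<notin> supp F \<inter> supp G" for k F G x
  proof -
    \<comment> \<open>A point outside the support of the series is a zero of every
      coefficient.\<close>
    have "x \<notin> supp_series (\<lambda>k. c k F G)" using loc[OF that(1,2)] that(3) by (auto simp: c(2)[OF that(1,2)])
    then show ?thesis
      unfolding supp_series_def using subsetD[OF closure_subset, of x "{x. \<exists>k. c k F G x \<noteq> 0}"] by auto
  qed
  have "c k F G \<in> flat_ideal atlas X" "c k G F \<in> flat_ideal atlas X"
    if F: "F \<in> flat_ideal atlas X" and G: "G \<in> smooth_functions atlas" for k F G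
    by (rule local_operator_preserves_flat_ideal[of "\<lambda>F. c k F G", OF _ _ _ F]
        local_operator_preserves_flat_ideal[of "\<lambda>F. c k G F", OF _ _ _ F];
        simp add: closed add zero G)+
  then have "star_ideal_axioms ?C st (flat_ideal atlas X)"
    by unfold_locales (auto simp: c(2) flat_ideal_smooth)
  then show ?thesis
    using smooth_algebra_complex_comm_algebra sp flat_ideal_is_ideal by (intro star_ideal.intro)
qed

end

theorem proposition1p3:
  fixes atlas :: "('m::{t2_space,second_countable_topology}, 'e::{real_inner,heine_borel}) chart set"
    and P :: "('m, 'e) chart \<Rightarrow> 'e \<Rightarrow> ('e \<Rightarrow>\<^sub>L real) \<Rightarrow> ('e \<Rightarrow>\<^sub>L real) \<Rightarrow> real"
    and star :: "(nat \<Rightarrow> 'm \<Rightarrow> complex) \<Rightarrow> (nat \<Rightarrow> 'm \<Rightarrow> complex) \<Rightarrow> (nat \<Rightarrow> 'm \<Rightarrow> complex)"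
    and X :: "'m set"
  assumes "poisson_manifold atlas P"
    and "local_star_product atlas P star"
    and "closed X"
  shows "algebra_ideal (hseries (flat_ideal atlas X)) (deformed (smooth_algebra atlas) star) \<and>
    (\<exists>starX. star_product (whitney_algebra atlas X) (global_whitney_bracket atlas P X) starX \<and>
       short_exact
         ((deformed (smooth_algebra atlas) star)\<lparr>carrier := hseries (flat_ideal atlas X)\<rparr>)
         (deformed (smooth_algebra atlas) star)
         (deformed (whitney_algebra atlas X) starX)
         (\<lambda>a. a) (whitney_projection atlas X))"
proof -
  have M: "smooth_manifold atlas" using assms(1) by (simp add: poisson_manifold_def)
  then obtain A :: "'e set" where "finite A" "span A = UNIV"
    unfolding smooth_manifold_def by (elim conjE exE) (rule that)
  \<comment> \<open>The frame is obtained from the finite spanning set in the definition of a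
    manifold, dimension zero included.\<close>
  from parseval_frame_exists[OF this] obtain B :: "'e set" where "parseval_frame B" by (rule exE)
  with M interpret manifold_with_frame atlas B by (rule manifold_with_frame.intro)
  interpret star_ideal "smooth_algebra atlas" "poisson_bracket atlas P" star "flat_ideal atlas X"
    by (rule local_star_product_star_ideal[OF assms(2)])
  have "whitney_algebra atlas X = quotient_algebra"
    by (simp add: whitney_algebra_def quotient_algebra_def Let_def)
  moreover have "global_whitney_bracket atlas P X = quotient_bracket"
    by (simp add: global_whitney_bracket_def quotient_bracket_def fun_eq_iff)
  moreover have "whitney_projection atlas X = series_coset"
    by (simp add: whitney_projection_def series_coset_def fun_eq_iff)
  ultimately show ?thesis
    using series_algebra_ideal quotient_star_product series_short_exact by auto
qed

end
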